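(* Let $(A\to M,\rho,[\cdot,\cdot])$ be a Lie algebroid. The map $$\{\text{equivalence classes of }A\text{-Manin pairs}\}\to\{\text{equivalence classes of Dirac bialgebroids over }A\}$$ that sends the class of $(C,U)$ (with structure maps $\iota,\Phi$) to the class of $(A,U,\iota)$ is a bijection.
   Context: Courant algebroid: a vector bundle $C\to M$ with fibrewise nondegenerate symmetric pairing $\langle\cdot,\cdot\rangle_C$, $\mathbb R$-bilinear bracket $[\![\cdot,\cdot]\!]_C$ on $\Gamma(C)$ and anchor $\rho_C\colon C\to TM$ satisfying (1) $[\![c_1,[\![c_2,c_3]\!]]\!]=[\![[\![c_1,c_2]\!],c_3]\!]+[\![c_2,[\![c_1,c_3]\!]]\!]$, (2) $\rho_C(c_1)\langle c_2,c_3\rangle=\langle[\![c_1,c_2]\!],c_3\rangle+\langle c_2,[\![c_1,c_3]\!]\rangle$, (3) $[\![c_1,c_2]\!]+[\![c_2,c_1]\!]=\mathcal D\langle c_1,c_2\rangle$, with $\langle\mathcal Df,c\rangle=\rho_C(c)(f)$. A Dirac structure in $C$ is a subbundle $U=U^\perp$ with $\Gamma(U)$ closed under the bracket; it is then a Lie algebroid. A Manin pair $(C,U)$ is a Courant algebroid $C$ with a Dirac structure $U$. $A\oplus T^*M$ is a degenerate Courant algebroid (all axioms except nondegeneracy) with anchor $\rho\circ\mathrm{pr}_A$, pairing $\langle(a_1,\theta_1),(a_2,\theta_2)\rangle_d=\theta_2(\rho(a_1))+\theta_1(\rho(a_2))$ and bracket $[(a_1,\theta_1),(a_2,\theta_2)]_d=([a_1,a_2],\mathcal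 L_{\rho(a_1)}\theta_2-i_{\rho(a_2)}d\theta_1)$. A (degenerate) Courant morphism $A\oplus T^*M\to C$ is a vector bundle morphism over $\mathrm{id}_M$ preserving anchors, pairings and brackets. The pairing of $TM\oplus A^*$ with $A\oplus T^*M$ is $\langle(X,\alpha),(a,\theta)\rangle=\alpha(a)+\theta(X)$. An $A$-Manin pair over $M$ is a Manin pair $(C,U)$ over $M$ together with structure maps: (a) an injective vector bundle morphism $\iota\colon U\to TM\oplus A^*$ with $\rho_U:=\rho_C|_U=\mathrm{pr}_{TM}\circ\iota$, and (b) a (degenerate) Courant morphism $\Phi\colon A\oplus T^*M\to C$ such that $\Phi(A\oplus T^*M)+U=C$ and $\langle u,\Phi(\tau)\rangle_C=\langle\iota(u),\tau\rangle$ for all $(u,\tau)\in U\times_M(A\oplus T^*M)$. Let $(U,\rho_U,[\cdot,\cdot]_U)$ be a Lie algebroid over $M$ and $\iota\colon U\to TM\oplus A^*$ an injective vector bundle morphism with $\mathrm{pr}_{TM}\circ\iota=\rho_U$. The triple $(A,U,\iota)$ is a Dirac bialgebroid over $A$ if $U$ is the Dirac structure and $\iota$ the injective morphism of an $A$-Manin pair. Two $A$-Manin pairs $(C,U)$, $(C',U')$ (respectively two Dirac bialgebroids $(A,U,\iota)$, $(A,U',\iota')$) are equivalent if they define the same Lie algebroid $\iota(U)=\iota'(U')$ in the $\mathrm{pr}_{TM}$-anchored vector bundle $TM\oplus A^*$. *)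

theory Defs
  imports "HOL-Analysis.Analysis" "HOL-Library.Function_Algebras"
begin

text \<open>Functions into a real vector space form a real vector space under the pointwise operations;
  tangent vectors, covectors and sections below are all functions of this kind.\<close>

instantiation "fun" :: (type, real_vector) real_vector
begin

definition scaleR_fun_def: "r *\<^sub>R f = (\<lambda>x. r *\<^sub>R f x)"

instance
  by standard (simp_all add: scaleR_fun_def fun_eq_iff scaleR_add_right scaleR_add_left)

end

definition linear_between :: "'v::real_vector set \<Rightarrow> 'w::real_vector set \<Rightarrow> ('v \<Rightarrow> 'w) \<Rightarrow> bool" where
  "linear_between S T h \<longleftrightarrow> h ` S \<subseteq> T \<and>
     (\<forall>v\<in>S. \<forall>w\<in>S. h (v + w) = h v + h w) \<and> (\<forall>r. \<forall>v\<in>S. h (r *\<^sub>R v) = r *\<^sub>R h v)"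

definition is_basis :: "'v::real_vector set \<Rightarrow> 'v list \<Rightarrow> bool" where
  "is_basis S vs \<longleftrightarrow> distinct vs \<and> independent (set vs) \<and> span (set vs) = S"

section \<open>Smooth manifolds\<close>

text \<open>In finite dimension, the conditions \<open>k_smooth_on k S f\<close> for all \<open>k\<close> together say that \<open>f\<close>
  is \<open>C\<^sup>\<infinity>\<close> on the open set \<open>S\<close>: \<open>f\<close> is differentiable and its directional derivatives are again smooth.\<close>

primrec k_smooth_on :: "nat \<Rightarrow> 'e::real_normed_vector set \<Rightarrow> ('e \<Rightarrow> 'f::real_normed_vector) \<Rightarrow> bool" where
  "k_smooth_on 0 S f \<longleftrightarrow> continuous_on S f"
| "k_smooth_on (Suc k) S f \<longleftrightarrow>
     (\<exists>f'. (\<forall>x\<in>S. (f has_derivative f' x) (at x)) \<and> (\<forall>v. k_smooth_on k S (\<lambda>x. f' x v)))"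

definition smooth_on :: "'e::real_normed_vector set \<Rightarrow> ('e \<Rightarrow> 'f::real_normed_vector) \<Rightarrow> bool" where
  "smooth_on S f \<longleftrightarrow> (\<forall>k. k_smooth_on k S f)"

type_synonym ('m, 'e) atlas = "('m set \<times> ('m \<Rightarrow> 'e)) set"

text \<open>The points of the manifold are all elements of a Hausdorff, second countable type \<open>'m\<close>.  The model
  space \<open>'e\<close> is a finite-dimensional inner product space; the class \<open>euclidean_space\<close> is not used for it
  because it would exclude manifolds of dimension 0.\<close>

definition smooth_manifold ::
    "('m::{t2_space,second_countable_topology}, 'e::real_inner) atlas \<Rightarrow> bool" where
  "smooth_manifold M \<longleftrightarrow>
     (\<exists>bs :: 'e list. is_basis UNIV bs) \<and>
     (\<Union>(W, \<phi>)\<in>M. W) = UNIV \<and>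
     (\<forall>(W, \<phi>)\<in>M. open W \<and> open (\<phi> ` W) \<and> homeomorphism W (\<phi> ` W) \<phi> (inv_into W \<phi>)) \<and>
     (\<forall>(W, \<phi>)\<in>M. \<forall>(V, \<psi>)\<in>M. smooth_on (\<phi> ` (W \<inter> V)) (\<psi> \<circ> inv_into W \<phi>))"

definition smooth_fun_on ::
    "('m::topological_space, 'e::real_inner) atlas \<Rightarrow> 'm set \<Rightarrow> ('m \<Rightarrow> real) \<Rightarrow> bool" where
  "smooth_fun_on M V f \<longleftrightarrow> (\<forall>(W, \<phi>)\<in>M. smooth_on (\<phi> ` (W \<inter> V)) (f \<circ> inv_into W \<phi>))"

abbreviation smooth_funs :: "('m::topological_space, 'e::real_inner) atlas \<Rightarrow> ('m \<Rightarrow> real) set" where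
  "smooth_funs M \<equiv> {f. smooth_fun_on M UNIV f}"

section \<open>Vector bundles\<close>

text \<open>The fibres of a vector bundle are subspaces of one ambient real vector space \<open>'v\<close> (of any dimension),
  so that the total space is \<open>SIGMA p:UNIV. fibre E p\<close>.  A local trivialisation over \<open>W\<close> is recorded by the
  local frame over \<open>W\<close> that it sends to the standard basis; \<open>frames\<close> is a bundle atlas of such frames.\<close>

record ('m, 'v) vbundle =
  fibre :: "'m \<Rightarrow> 'v set"
  frames :: "('m set \<times> ('m \<Rightarrow> 'v) list) set"

definition smooth_section_on ::
    "('m::topological_space, 'e::real_inner) atlas \<Rightarrow> ('m, 'v::real_vector, 'z) vbundle_scheme
      \<Rightarrow> 'm set \<Rightarrow> ('m \<Rightarrow> 'v) \<Rightarrow> bool" where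
  "smooth_section_on M E V s \<longleftrightarrow> (\<forall>p\<in>V. s p \<in> fibre E p) \<and>
     (\<forall>(W, es)\<in>frames E. \<exists>c :: nat \<Rightarrow> 'm \<Rightarrow> real.
        (\<forall>i<length es. smooth_fun_on M (W \<inter> V) (c i)) \<and>
        (\<forall>p\<in>W \<inter> V. s p = (\<Sum>i<length es. c i p *\<^sub>R (es ! i) p)))"

text \<open>The last condition makes the transition functions between frames smooth.  The rank
  \<open>length es\<close> is locally constant.\<close>

definition vector_bundle ::
    "('m::topological_space, 'e::real_inner) atlas \<Rightarrow> ('m, 'v::real_vector, 'z) vbundle_scheme \<Rightarrow> bool" where
  "vector_bundle M E \<longleftrightarrow>
     (\<forall>p. subspace (fibre E p)) \<and>
     (\<Union>(W, es)\<in>frames E. W) = UNIV \<and>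
     (\<forall>(W, es)\<in>frames E. open W \<and> (\<forall>p\<in>W. is_basis (fibre E p) (map (\<lambda>e. e p) es)) \<and>
        (\<forall>e\<in>set es. smooth_section_on M E W e))"

definition sections ::
    "('m::topological_space, 'e::real_inner) atlas \<Rightarrow> ('m, 'v::real_vector, 'z) vbundle_scheme
      \<Rightarrow> ('m \<Rightarrow> 'v) set" where
  "sections M E = {s. smooth_section_on M E UNIV s}"

text \<open>Morphisms over the identity; being smooth on frames says that the matrix entries of \<open>h\<close>
  in local trivialisations are smooth.\<close>

definition vb_morphism ::
    "('m::topological_space, 'e::real_inner) atlas \<Rightarrow> ('m, 'v::real_vector, 'y) vbundle_scheme
      \<Rightarrow> ('m, 'w::real_vector, 'z) vbundle_scheme \<Rightarrow> ('m \<Rightarrow> 'v \<Rightarrow> 'w) \<Rightarrow> bool" where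
  "vb_morphism M E F h \<longleftrightarrow>
     (\<forall>p. linear_between (fibre E p) (fibre F p) (h p)) \<and>
     (\<forall>(W, es)\<in>frames E. \<forall>e\<in>set es. smooth_section_on M F W (\<lambda>p. h p (e p)))"

definition subbundle ::
    "('m::topological_space, 'e::real_inner) atlas \<Rightarrow> ('m, 'v::real_vector, 'y) vbundle_scheme
      \<Rightarrow> ('m, 'v, 'z) vbundle_scheme \<Rightarrow> bool" where
  "subbundle M U E \<longleftrightarrow> vector_bundle M U \<and> (\<forall>p. fibre U p \<subseteq> fibre E p) \<and> vb_morphism M U E (\<lambda>p v. v)"

definition direct_sum ::
    "('m, 'v::real_vector, 'y) vbundle_scheme \<Rightarrow> ('m, 'w::real_vector, 'z) vbundle_scheme
      \<Rightarrow> ('m, 'v \<times> 'w) vbundle" where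
  "direct_sum E F = \<lparr> fibre = (\<lambda>p. fibre E p \<times> fibre F p),
     frames = {(W \<inter> V, map (\<lambda>e p. (e p, 0)) es @ map (\<lambda>e p. (0, e p)) fs) | W es V fs.
                 (W, es) \<in> frames E \<and> (V, fs) \<in> frames F} \<rparr>"

text \<open>Linear functionals on a fibre are made total by the value 0 outside the fibre.
  The frames of the dual bundle are the dual frames.\<close>

definition dual_fibre :: "'v::real_vector set \<Rightarrow> ('v \<Rightarrow> real) set" where
  "dual_fibre S = {\<alpha>. linear_between S UNIV \<alpha> \<and> (\<forall>v. v \<notin> S \<longrightarrow> \<alpha> v = 0)}"

definition dual_bundle :: "('m, 'v::real_vector, 'z) vbundle_scheme \<Rightarrow> ('m, 'v \<Rightarrow> real) vbundle" where
  "dual_bundle E = \<lparr> fibre = (\<lambda>p. dual_fibre (fibre E p)),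
     frames = {(W, \<epsilon>s). \<exists>es. (W, es) \<in> frames E \<and> length \<epsilon>s = length es \<and>
       (\<forall>p\<in>W. \<forall>i<length es. (\<epsilon>s ! i) p \<in> dual_fibre (fibre E p) \<and>
          (\<forall>j<length es. (\<epsilon>s ! i) p ((es ! j) p) = (if i = j then 1 else 0)))} \<rparr>"

section \<open>Tangent and cotangent bundle\<close>

text \<open>Tangent vectors at a point are derivations of the algebra of smooth functions, made total by
  the value 0 on non-smooth functions.\<close>

type_synonym 'm tvec = "('m \<Rightarrow> real) \<Rightarrow> real"
type_synonym 'm covec = "'m tvec \<Rightarrow> real"

definition tangent_space :: "('m::topological_space, 'e::real_inner) atlas \<Rightarrow> 'm \<Rightarrow> 'm tvec set" where
  "tangent_space M p = {X. linear_between (smooth_funs M) UNIV X \<and>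
     (\<forall>f\<in>smooth_funs M. \<forall>g\<in>smooth_funs M. X (f * g) = X f * g p + f p * X g) \<and>
     (\<forall>f. f \<notin> smooth_funs M \<longrightarrow> X f = 0)}"

definition coord_vector ::
    "('m::topological_space, 'e::real_inner) atlas \<Rightarrow> 'm set \<times> ('m \<Rightarrow> 'e) \<Rightarrow> 'e \<Rightarrow> 'm \<Rightarrow> 'm tvec" where
  "coord_vector M = (\<lambda>(W, \<phi>) b p f. if f \<in> smooth_funs M
     then frechet_derivative (f \<circ> inv_into W \<phi>) (at (\<phi> p)) b else 0)"

definition tangent_bundle :: "('m::topological_space, 'e::real_inner) atlas \<Rightarrow> ('m, 'm tvec) vbundle" where
  "tangent_bundle M = \<lparr> fibre = tangent_space M,
     frames = {(W, map (coord_vector M (W, \<phi>)) bs) | W \<phi> bs. (W, \<phi>) \<in> M \<and> is_basis UNIV bs} \<rparr>"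

abbreviation cotangent_bundle :: "('m::topological_space, 'e::real_inner) atlas \<Rightarrow> ('m, 'm covec) vbundle" where
  "cotangent_bundle M \<equiv> dual_bundle (tangent_bundle M)"

definition vf_bracket :: "('m \<Rightarrow> 'm tvec) \<Rightarrow> ('m \<Rightarrow> 'm tvec) \<Rightarrow> 'm \<Rightarrow> 'm tvec" where
  "vf_bracket X Y = (\<lambda>p f. X p (\<lambda>q. Y q f) - Y p (\<lambda>q. X q f))"

text \<open>The 1-form \<open>\<eta>\<close> determined by \<open>\<eta>(Z) = F Z\<close> for all vector fields \<open>Z\<close>, where \<open>F\<close> is
  \<open>C\<^sup>\<infinity>(M)\<close>-linear.\<close>

definition one_form_of ::
    "('m::topological_space, 'e::real_inner) atlas \<Rightarrow> (('m \<Rightarrow> 'm tvec) \<Rightarrow> 'm \<Rightarrow> real) \<Rightarrow> 'm \<Rightarrow> 'm covec" where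
  "one_form_of M F = (THE \<eta>. \<eta> \<in> sections M (cotangent_bundle M) \<and>
     (\<forall>Z\<in>sections M (tangent_bundle M). \<forall>p. \<eta> p (Z p) = F Z p))"

text \<open>\<open>(L\<^sub>X \<theta>)(Z) = X(\<theta>(Z)) - \<theta>([X, Z])\<close> and
  \<open>d\<theta>(X, Z) = X(\<theta>(Z)) - Z(\<theta>(X)) - \<theta>([X, Z])\<close>.\<close>

definition lie_derivative ::
    "('m::topological_space, 'e::real_inner) atlas \<Rightarrow> ('m \<Rightarrow> 'm tvec) \<Rightarrow> ('m \<Rightarrow> 'm covec) \<Rightarrow> 'm \<Rightarrow> 'm covec" where
  "lie_derivative M X \<theta> = one_form_of M (\<lambda>Z p. X p (\<lambda>q. \<theta> q (Z q)) - \<theta> p (vf_bracket X Z p))"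

definition ext_deriv :: "('m \<Rightarrow> 'm covec) \<Rightarrow> ('m \<Rightarrow> 'm tvec) \<Rightarrow> ('m \<Rightarrow> 'm tvec) \<Rightarrow> 'm \<Rightarrow> real" where
  "ext_deriv \<theta> X Z p = X p (\<lambda>q. \<theta> q (Z q)) - Z p (\<lambda>q. \<theta> q (X q)) - \<theta> p (vf_bracket X Z p)"

definition contract_d ::
    "('m::topological_space, 'e::real_inner) atlas \<Rightarrow> ('m \<Rightarrow> 'm tvec) \<Rightarrow> ('m \<Rightarrow> 'm covec) \<Rightarrow> 'm \<Rightarrow> 'm covec" where
  "contract_d M X \<theta> = one_form_of M (ext_deriv \<theta> X)"

section \<open>Lie algebroids\<close>

record ('m, 'v) algebroid = "('m, 'v) vbundle" +
  anchor :: "'m \<Rightarrow> 'v \<Rightarrow> 'm tvec"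
  bracket :: "('m \<Rightarrow> 'v) \<Rightarrow> ('m \<Rightarrow> 'v) \<Rightarrow> 'm \<Rightarrow> 'v"

definition bilinear_bracket ::
    "('m::topological_space, 'e::real_inner) atlas \<Rightarrow> ('m, 'v::real_vector, 'z) algebroid_scheme \<Rightarrow> bool" where
  "bilinear_bracket M L \<longleftrightarrow> (\<forall>s\<in>sections M L.
     linear_between (sections M L) (sections M L) (\<lambda>t. bracket L s t) \<and>
     linear_between (sections M L) (sections M L) (\<lambda>t. bracket L t s))"

definition lie_algebroid ::
    "('m::topological_space, 'e::real_inner) atlas \<Rightarrow> ('m, 'v::real_vector, 'z) algebroid_scheme \<Rightarrow> bool" where
  "lie_algebroid M L \<longleftrightarrow> vector_bundle M L \<and> vb_morphism M L (tangent_bundle M) (anchor L) \<and>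
     bilinear_bracket M L \<and>
     (\<forall>s\<in>sections M L. \<forall>t\<in>sections M L. bracket L s t = - bracket L t s) \<and>
     (\<forall>s\<in>sections M L. \<forall>t\<in>sections M L. \<forall>u\<in>sections M L.
        bracket L s (bracket L t u) + bracket L t (bracket L u s) + bracket L u (bracket L s t) = 0) \<and>
     (\<forall>s\<in>sections M L. \<forall>t\<in>sections M L. \<forall>f\<in>smooth_funs M.
        bracket L s (\<lambda>p. f p *\<^sub>R t p) = (\<lambda>p. f p *\<^sub>R bracket L s t p + anchor L p (s p) f *\<^sub>R t p))"

text \<open>Equality of Lie algebroids with fibres in the same ambient space.  Equality of records would be
  too fine: it depends on the chosen bundle atlas and on irrelevant values of \<open>anchor\<close> and \<open>bracket\<close>.\<close>

definition same_algebroid ::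
    "('m::topological_space, 'e::real_inner) atlas \<Rightarrow> ('m, 'v::real_vector) algebroid
      \<Rightarrow> ('m, 'v) algebroid \<Rightarrow> bool" where
  "same_algebroid M L L' \<longleftrightarrow> fibre L = fibre L' \<and> sections M L = sections M L' \<and>
     (\<forall>p. \<forall>v\<in>fibre L p. anchor L p v = anchor L' p v) \<and>
     (\<forall>s\<in>sections M L. \<forall>t\<in>sections M L. bracket L s t = bracket L' s t)"

section \<open>Courant algebroids and Manin pairs\<close>

record ('m, 'v) courant = "('m, 'v) algebroid" +
  pairing :: "'m \<Rightarrow> 'v \<Rightarrow> 'v \<Rightarrow> real"

definition courant_D :: "('m, 'v::real_vector, 'z) courant_scheme \<Rightarrow> ('m \<Rightarrow> real) \<Rightarrow> 'm \<Rightarrow> 'v" where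
  "courant_D C f = (\<lambda>p. THE d. d \<in> fibre C p \<and> (\<forall>c\<in>fibre C p. pairing C p d c = anchor C p c f))"

definition courant_algebroid ::
    "('m::topological_space, 'e::real_inner) atlas \<Rightarrow> ('m, 'v::real_vector, 'z) courant_scheme \<Rightarrow> bool" where
  "courant_algebroid M C \<longleftrightarrow> vector_bundle M C \<and> vb_morphism M C (tangent_bundle M) (anchor C) \<and>
     bilinear_bracket M C \<and>
     (\<forall>p. \<forall>v\<in>fibre C p. linear_between (fibre C p) UNIV (pairing C p v)) \<and>
     (\<forall>p. \<forall>v\<in>fibre C p. \<forall>w\<in>fibre C p. pairing C p v w = pairing C p w v) \<and>
     (\<forall>p. \<forall>v\<in>fibre C p. (\<forall>w\<in>fibre C p. pairing C p v w = 0) \<longrightarrow> v = 0) \<and>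
     (\<forall>(W, es)\<in>frames C. \<forall>e\<in>set es. \<forall>e'\<in>set es. smooth_fun_on M W (\<lambda>p. pairing C p (e p) (e' p))) \<and>
     (\<forall>c1\<in>sections M C. \<forall>c2\<in>sections M C. \<forall>c3\<in>sections M C.
        bracket C c1 (bracket C c2 c3) = bracket C (bracket C c1 c2) c3 + bracket C c2 (bracket C c1 c3)) \<and>
     (\<forall>c1\<in>sections M C. \<forall>c2\<in>sections M C. \<forall>c3\<in>sections M C. \<forall>p.
        anchor C p (c1 p) (\<lambda>q. pairing C q (c2 q) (c3 q)) =
          pairing C p (bracket C c1 c2 p) (c3 p) + pairing C p (c2 p) (bracket C c1 c3 p)) \<and>
     (\<forall>c1\<in>sections M C. \<forall>c2\<in>sections M C.
        bracket C c1 c2 + bracket C c2 c1 = courant_D C (\<lambda>q. pairing C q (c1 q) (c2 q)))"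

definition dirac_structure ::
    "('m::topological_space, 'e::real_inner) atlas \<Rightarrow> ('m, 'v::real_vector, 'y) courant_scheme
      \<Rightarrow> ('m, 'v, 'z) vbundle_scheme \<Rightarrow> bool" where
  "dirac_structure M C U \<longleftrightarrow> subbundle M U C \<and>
     (\<forall>p. fibre U p = {c \<in> fibre C p. \<forall>u\<in>fibre U p. pairing C p c u = 0}) \<and>
     (\<forall>s\<in>sections M U. \<forall>t\<in>sections M U. bracket C s t \<in> sections M U)"

definition dirac_algebroid ::
    "('m, 'v, 'y) courant_scheme \<Rightarrow> ('m, 'v, 'z) vbundle_scheme \<Rightarrow> ('m, 'v) algebroid" where
  "dirac_algebroid C U = \<lparr> fibre = fibre U, frames = frames U, anchor = anchor C, bracket = bracket C \<rparr>"

definition manin_pair ::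
    "('m::topological_space, 'e::real_inner) atlas \<Rightarrow> ('m, 'v::real_vector, 'y) courant_scheme
      \<Rightarrow> ('m, 'v, 'z) vbundle_scheme \<Rightarrow> bool" where
  "manin_pair M C U \<longleftrightarrow> courant_algebroid M C \<and> dirac_structure M C U"

text \<open>The degenerate Courant algebroid \<open>A \<oplus> T\<^sup>*M\<close>.\<close>

definition degenerate_courant ::
    "('m::topological_space, 'e::real_inner) atlas \<Rightarrow> ('m, 'a::real_vector, 'z) algebroid_scheme
      \<Rightarrow> ('m, 'a \<times> 'm covec) courant" where
  "degenerate_courant M A = \<lparr>
     fibre = fibre (direct_sum A (cotangent_bundle M)),
     frames = frames (direct_sum A (cotangent_bundle M)),
     anchor = (\<lambda>p (a, \<theta>). anchor A p a),
     bracket = (\<lambda>s t.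
       let a1 = (\<lambda>p. fst (s p)); \<theta>1 = (\<lambda>p. snd (s p)); a2 = (\<lambda>p. fst (t p)); \<theta>2 = (\<lambda>p. snd (t p));
           X1 = (\<lambda>p. anchor A p (a1 p)); X2 = (\<lambda>p. anchor A p (a2 p))
       in (\<lambda>p. (bracket A a1 a2 p, lie_derivative M X1 \<theta>2 p - contract_d M X2 \<theta>1 p))),
     pairing = (\<lambda>p (a1, \<theta>1) (a2, \<theta>2). \<theta>2 (anchor A p a1) + \<theta>1 (anchor A p a2)) \<rparr>"

definition courant_morphism ::
    "('m::topological_space, 'e::real_inner) atlas \<Rightarrow> ('m, 'v::real_vector, 'y) courant_scheme
      \<Rightarrow> ('m, 'w::real_vector, 'z) courant_scheme \<Rightarrow> ('m \<Rightarrow> 'v \<Rightarrow> 'w) \<Rightarrow> bool" where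
  "courant_morphism M E C \<Phi> \<longleftrightarrow> vb_morphism M E C \<Phi> \<and>
     (\<forall>p. \<forall>v\<in>fibre E p. anchor C p (\<Phi> p v) = anchor E p v) \<and>
     (\<forall>p. \<forall>v\<in>fibre E p. \<forall>w\<in>fibre E p. pairing C p (\<Phi> p v) (\<Phi> p w) = pairing E p v w) \<and>
     (\<forall>s\<in>sections M E. \<forall>t\<in>sections M E.
        bracket C (\<lambda>p. \<Phi> p (s p)) (\<lambda>p. \<Phi> p (t p)) = (\<lambda>p. \<Phi> p (bracket E s t p)))"

section \<open>A-Manin pairs and Dirac bialgebroids over A\<close>

abbreviation tangent_plus_dual ::
    "('m::topological_space, 'e::real_inner) atlas \<Rightarrow> ('m, 'a::real_vector, 'z) algebroid_scheme
      \<Rightarrow> ('m, 'm tvec \<times> ('a \<Rightarrow> real)) vbundle" where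
  "tangent_plus_dual M A \<equiv> direct_sum (tangent_bundle M) (dual_bundle A)"

definition canonical_pairing :: "'m tvec \<times> ('a \<Rightarrow> real) \<Rightarrow> 'a \<times> 'm covec \<Rightarrow> real" where
  "canonical_pairing = (\<lambda>(X, \<alpha>) (a, \<theta>). \<alpha> a + \<theta> X)"

definition injective_anchored_morphism ::
    "('m::topological_space, 'e::real_inner) atlas \<Rightarrow> ('m, 'a::real_vector, 'y) algebroid_scheme
      \<Rightarrow> ('m, 'v::real_vector) algebroid \<Rightarrow> ('m \<Rightarrow> 'v \<Rightarrow> 'm tvec \<times> ('a \<Rightarrow> real)) \<Rightarrow> bool" where
  "injective_anchored_morphism M A U \<iota> \<longleftrightarrow> vb_morphism M U (tangent_plus_dual M A) \<iota> \<and>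
     (\<forall>p. inj_on (\<iota> p) (fibre U p)) \<and> (\<forall>p. \<forall>u\<in>fibre U p. anchor U p u = fst (\<iota> p u))"

definition A_manin_pair ::
    "('m::topological_space, 'e::real_inner) atlas \<Rightarrow> ('m, 'a::real_vector) algebroid
      \<Rightarrow> ('m, 'c::real_vector) courant \<Rightarrow> ('m, 'c) vbundle
      \<Rightarrow> ('m \<Rightarrow> 'c \<Rightarrow> 'm tvec \<times> ('a \<Rightarrow> real)) \<Rightarrow> ('m \<Rightarrow> 'a \<times> 'm covec \<Rightarrow> 'c) \<Rightarrow> bool" where
  "A_manin_pair M A C U \<iota> \<Phi> \<longleftrightarrow> manin_pair M C U \<and>
     injective_anchored_morphism M A (dirac_algebroid C U) \<iota> \<and>
     courant_morphism M (degenerate_courant M A) C \<Phi> \<and>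
     (\<forall>p. {\<Phi> p \<tau> + u | \<tau> u. \<tau> \<in> fibre (degenerate_courant M A) p \<and> u \<in> fibre U p} = fibre C p) \<and>
     (\<forall>p. \<forall>u\<in>fibre U p. \<forall>\<tau>\<in>fibre (degenerate_courant M A) p.
        pairing C p u (\<Phi> p \<tau>) = canonical_pairing (\<iota> p u) \<tau>)"

definition dirac_bialgebroid ::
    "('m::topological_space, 'e::real_inner) atlas \<Rightarrow> ('m, 'a::real_vector) algebroid
      \<Rightarrow> ('m, 'c::real_vector) algebroid \<Rightarrow> ('m \<Rightarrow> 'c \<Rightarrow> 'm tvec \<times> ('a \<Rightarrow> real)) \<Rightarrow> bool" where
  "dirac_bialgebroid M A U \<iota> \<longleftrightarrow> lie_algebroid M U \<and> injective_anchored_morphism M A U \<iota> \<and>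
     (\<exists>C V \<Phi>. A_manin_pair M A C V \<iota> \<Phi> \<and> same_algebroid M U (dirac_algebroid C V))"

text \<open>The Lie algebroid \<open>\<iota>(U)\<close> in \<open>TM \<oplus> A\<^sup>*\<close>, with structure transported along the injective \<open>\<iota>\<close>.\<close>

definition image_algebroid ::
    "('m, 'v::real_vector) algebroid \<Rightarrow> ('m \<Rightarrow> 'v \<Rightarrow> 'm tvec \<times> ('a \<Rightarrow> real))
      \<Rightarrow> ('m, 'm tvec \<times> ('a \<Rightarrow> real)) algebroid" where
  "image_algebroid U \<iota> = \<lparr>
     fibre = (\<lambda>p. \<iota> p ` fibre U p),
     frames = {(W, map (\<lambda>e p. \<iota> p (e p)) es) | W es. (W, es) \<in> frames U},
     anchor = (\<lambda>p. fst),
     bracket = (\<lambda>s t p. \<iota> p (bracket U (\<lambda>q. the_inv_into (fibre U q) (\<iota> q) (s q))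
                                      (\<lambda>q. the_inv_into (fibre U q) (\<iota> q) (t q)) p)) \<rparr>"

type_synonym ('m, 'a, 'c) A_manin_data =
  "('m, 'c) courant \<times> ('m, 'c) vbundle \<times>
   ('m \<Rightarrow> 'c \<Rightarrow> 'm tvec \<times> ('a \<Rightarrow> real)) \<times> ('m \<Rightarrow> 'a \<times> 'm covec \<Rightarrow> 'c)"

type_synonym ('m, 'a, 'c) bialgebroid_data =
  "('m, 'c) algebroid \<times> ('m \<Rightarrow> 'c \<Rightarrow> 'm tvec \<times> ('a \<Rightarrow> real))"

definition A_manin_pairs ::
    "('m::topological_space, 'e::real_inner) atlas \<Rightarrow> ('m, 'a::real_vector) algebroid
      \<Rightarrow> ('m, 'a, 'c::real_vector) A_manin_data set" where
  "A_manin_pairs M A = {(C, U, \<iota>, \<Phi>). A_manin_pair M A C U \<iota> \<Phi>}"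

text \<open>\<open>A\<close> being fixed, the triple \<open>(A, U, \<iota>)\<close> is represented by \<open>(U, \<iota>)\<close>.\<close>

definition dirac_bialgebroids ::
    "('m::topological_space, 'e::real_inner) atlas \<Rightarrow> ('m, 'a::real_vector) algebroid
      \<Rightarrow> ('m, 'a, 'c::real_vector) bialgebroid_data set" where
  "dirac_bialgebroids M A = {(U, \<iota>). dirac_bialgebroid M A U \<iota>}"

definition manin_equiv ::
    "('m::topological_space, 'e::real_inner) atlas \<Rightarrow> ('m, 'a::real_vector) algebroid
      \<Rightarrow> ('m, 'a, 'c::real_vector) A_manin_data rel" where
  "manin_equiv M A = {((C, U, \<iota>, \<Phi>), (C', U', \<iota>', \<Phi>')).
     (C, U, \<iota>, \<Phi>) \<in> A_manin_pairs M A \<and> (C', U', \<iota>', \<Phi>') \<in> A_manin_pairs M A \<and>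
     same_algebroid M (image_algebroid (dirac_algebroid C U) \<iota>) (image_algebroid (dirac_algebroid C' U') \<iota>')}"

definition bialgebroid_equiv ::
    "('m::topological_space, 'e::real_inner) atlas \<Rightarrow> ('m, 'a::real_vector) algebroid
      \<Rightarrow> ('m, 'a, 'c::real_vector) bialgebroid_data rel" where
  "bialgebroid_equiv M A = {((U, \<iota>), (U', \<iota>')).
     (U, \<iota>) \<in> dirac_bialgebroids M A \<and> (U', \<iota>') \<in> dirac_bialgebroids M A \<and>
     same_algebroid M (image_algebroid U \<iota>) (image_algebroid U' \<iota>')}"

lemma equiv_manin_equiv: "equiv (A_manin_pairs M A) (manin_equiv M A)"
  unfolding equiv_def refl_on_def sym_def trans_def manin_equiv_def same_algebroid_def by auto

lemma equiv_bialgebroid_equiv: "equiv (dirac_bialgebroids M A) (bialgebroid_equiv M A)"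
  unfolding equiv_def refl_on_def sym_def trans_def bialgebroid_equiv_def same_algebroid_def by auto

end

theory Submission
  imports Defs
begin

text \<open>Both equivalence relations compare the same object, the Lie algebroid \<open>\<iota>(U)\<close> inside \<open>TM \<oplus> A\<^sup>*\<close>.  Hence, once
  \<open>(C, U, \<iota>, \<Phi>) \<mapsto> (U, \<iota>)\<close> is known to take \<open>A\<close>-Manin pairs to Dirac bialgebroids, it preserves and reflects
  equivalence, and the induced map of classes is well defined and injective.  It is surjective because a
  Dirac bialgebroid comes, by definition, with an \<open>A\<close>-Manin pair whose Dirac structure is the same
  Lie algebroid with the same \<open>\<iota>\<close>; the images under \<open>\<iota>\<close> then agree (\<open>same_algebroid_image\<close>).

  The substance is that a Dirac structure \<open>U\<close> in a Courant algebroid \<open>C\<close> is a Lie algebroid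
  (\<open>dirac_structure_lie_algebroid\<close>).  The pairing vanishes on \<open>U\<close>, so that the bracket is antisymmetric on
  sections of \<open>U\<close> and the Jacobi identity of \<open>C\<close> takes its cyclic form.  The Leibniz rule (\<open>courant_leibniz\<close>) is
  deduced from invariance and nondegeneracy of the pairing, which has to be tested on global
  sections with a prescribed value at a point (\<open>section_through\<close>).  The anchor of \<open>U\<close> is smooth because bundle morphisms map smooth
  sections to smooth sections (\<open>vb_morphism_smooth_section\<close>).  Here the coefficients of a section in a frame are found locally
  and glued, which requires that they are unique; for the tangent bundle this is the independence of
  coordinate vectors as derivations of global smooth functions (\<open>coord_vector_coeffs_zero\<close>).

  Both the global sections and the global functions are obtained by cutting off local ones
  with bump functions (\<open>bump_function_exists\<close>), which rest on the smoothness of \<open>exp (- 1 / x)\<close> extended by zero and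
  on the compactness of closed balls in the model space.\<close>

section \<open>Calculus of smooth functions\<close>

lemma k_smooth_on_subset: "k_smooth_on k S f \<Longrightarrow> T \<subseteq> S \<Longrightarrow> k_smooth_on k T f"
proof (induction k arbitrary: f)
  case 0
  then show ?case by (auto intro: continuous_on_subset)
next
  case (Suc k)
  then show ?case by (simp, meson subsetD)
qed

lemma k_smooth_on_SucD: "k_smooth_on (Suc k) S f \<Longrightarrow> k_smooth_on k S f"
proof (induction k arbitrary: f)
  case 0
  then show ?case
    by (auto intro!: continuous_at_imp_continuous_on dest: has_derivative_continuous)
next
  case (Suc k)
  from Suc.prems obtain f' where
    "\<forall>x\<in>S. (f has_derivative f' x) (at x)" "\<forall>v. k_smooth_on (Suc k) S (\<lambda>x. f' x v)"
    unfolding k_smooth_on.simps(2)[of "Suc k"] by blast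
  with Suc.IH show ?case unfolding k_smooth_on.simps(2)[of k] by blast
qed

lemma k_smooth_on_cong:
  assumes "open S" "k_smooth_on k S f" "\<And>x. x \<in> S \<Longrightarrow> f x = g x"
  shows "k_smooth_on k S g"
proof (cases k)
  case 0
  then show ?thesis using assms continuous_on_cong[of S S f g] by simp
next
  case (Suc j)
  then obtain f' where f': "\<forall>x\<in>S. (f has_derivative f' x) (at x)" "\<forall>v. k_smooth_on j S (\<lambda>x. f' x v)"
    using assms(2) by auto
  have "\<forall>x\<in>S. (g has_derivative f' x) (at x)"
    using f'(1) assms(1,3) by (metis has_derivative_transform_within_open)
  with f'(2) Suc show ?thesis by auto
qed

text \<open>The definition of smoothness asks for one derivative on all of the set; as derivatives are
  unique, derivatives given locally fit together.\<close>

lemma k_smooth_on_local: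
  assumes "\<And>x. x \<in> S \<Longrightarrow> \<exists>T. open T \<and> x \<in> T \<and> k_smooth_on k T f"
  shows "k_smooth_on k S f"
  using assms
proof (induction k arbitrary: f)
  case 0
  have "isCont f x" if "x \<in> S" for x
    using 0[OF that] by (auto simp: continuous_on_eq_continuous_at)
  then show ?case by (simp add: continuous_at_imp_continuous_on)
next
  case (Suc k)
  let ?g = "\<lambda>x. frechet_derivative f (at x)"
  have *: "\<exists>T. open T \<and> x \<in> T \<and> (f has_derivative ?g x) (at x) \<and> (\<forall>v. k_smooth_on k T (\<lambda>y. ?g y v))"
    if x: "x \<in> S" for x
  proof -
    obtain T f' where T: "open T" "x \<in> T" "\<forall>y\<in>T. (f has_derivative f' y) (at y)"
      "\<forall>v. k_smooth_on k T (\<lambda>y. f' y v)"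
      using Suc.prems[OF x] by auto
    have f'_eq: "f' y = ?g y" if "y \<in> T" for y
      by (rule frechet_derivative_at) (use T(3) that in blast)
    have "k_smooth_on k T (\<lambda>y. ?g y v)" for v
      by (rule k_smooth_on_cong[OF T(1) T(4)[rule_format, of v]]) (simp add: f'_eq)
    moreover have "(f has_derivative ?g x) (at x)"
      using T(2,3) f'_eq[OF T(2)] by metis
    ultimately show ?thesis using T(1,2) by blast
  qed
  have "k_smooth_on k S (\<lambda>x. ?g x v)" for v
    by (rule Suc.IH) (use * in blast)
  moreover have "\<forall>x\<in>S. (f has_derivative ?g x) (at x)" using * by blast
  ultimately show ?case unfolding k_smooth_on.simps by (intro exI[of _ ?g] conjI allI)
qed

lemma k_smooth_on_const: "k_smooth_on k S (\<lambda>x. c)"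
proof (induction k arbitrary: c)
  case (Suc k)
  show ?case unfolding k_smooth_on.simps
    by (rule exI[of _ "\<lambda>x v. 0"]) (simp add: Suc)
qed simp

lemma k_smooth_on_add:
  "k_smooth_on k S f \<Longrightarrow> k_smooth_on k S g \<Longrightarrow> k_smooth_on k S (\<lambda>x. f x + g x)"
proof (induction k arbitrary: f g)
  case 0
  then show ?case by (auto intro: continuous_on_add)
next
  case (Suc k)
  from Suc.prems obtain f' g' where
    "\<forall>x\<in>S. (f has_derivative f' x) (at x)" "\<forall>v. k_smooth_on k S (\<lambda>x. f' x v)"
    "\<forall>x\<in>S. (g has_derivative g' x) (at x)" "\<forall>v. k_smooth_on k S (\<lambda>x. g' x v)"
    by auto
  with Suc.IH show ?case unfolding k_smooth_on.simps
    by (intro exI[of _ "\<lambda>x v. f' x v + g' x v"]) (auto intro: has_derivative_add)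
qed

lemma (in bounded_bilinear) k_smooth_on_prod:
  "k_smooth_on k S f \<Longrightarrow> k_smooth_on k S g \<Longrightarrow> k_smooth_on k S (\<lambda>x. prod (f x) (g x))"
proof (induction k arbitrary: f g)
  case 0
  then show ?case by (auto intro: continuous_on)
next
  case (Suc k)
  note fg = k_smooth_on_SucD[OF Suc.prems(1)] k_smooth_on_SucD[OF Suc.prems(2)]
  from Suc.prems obtain f' g' where
    "\<forall>x\<in>S. (f has_derivative f' x) (at x)" "\<forall>v. k_smooth_on k S (\<lambda>x. f' x v)"
    "\<forall>x\<in>S. (g has_derivative g' x) (at x)" "\<forall>v. k_smooth_on k S (\<lambda>x. g' x v)"
    by auto
  with Suc.IH fg show ?case unfolding k_smooth_on.simps
    by (intro exI[of _ "\<lambda>x v. prod (f x) (g' x v) + prod (f' x v) (g x)"])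
       (auto intro: k_smooth_on_add FDERIV)
qed

text \<open>The outer function is defined on the real line, so that its derivative, a linear map, is
  multiplication by its value at 1.\<close>

lemma k_smooth_on_compose_real:
  fixes h :: "real \<Rightarrow> real"
  shows "k_smooth_on k UNIV h \<Longrightarrow> k_smooth_on k S g \<Longrightarrow> k_smooth_on k S (\<lambda>x. h (g x))"
proof (induction k arbitrary: h g)
  case 0
  then show ?case using continuous_on_compose2[of UNIV h S g] by simp
next
  case (Suc k)
  note g = k_smooth_on_SucD[OF Suc.prems(2)]
  from Suc.prems obtain h' g' where
    h': "\<forall>x. (h has_derivative h' x) (at x)" "\<forall>v. k_smooth_on k UNIV (\<lambda>x. h' x v)" and
    g': "\<forall>x\<in>S. (g has_derivative g' x) (at x)" "\<forall>v. k_smooth_on k S (\<lambda>x. g' x v)"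
    by auto
  have lin: "h' y r = h' y 1 * r" for y r
  proof -
    have "linear (h' y)" using h'(1) has_derivative_linear by blast
    from linear_scale[OF this, of r 1] show ?thesis by simp
  qed
  have "((\<lambda>x. h (g x)) has_derivative (\<lambda>v. h' (g x) 1 * g' x v)) (at x)" if "x \<in> S" for x
    using has_derivative_compose[of g "g' x" x UNIV h "h' (g x)"] g'(1) h'(1) that
    by (simp flip: lin)
  moreover have "k_smooth_on k S (\<lambda>x. h' (g x) 1 * g' x v)" for v
    using Suc.IH[OF h'(2)[rule_format] g] g'(2)
    by (intro bounded_bilinear.k_smooth_on_prod[OF bounded_bilinear_mult]) auto
  ultimately show ?case unfolding k_smooth_on.simps
    by (intro exI[of _ "\<lambda>x v. h' (g x) 1 * g' x v"]) blast
qed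

text \<open>The standard flat function \<open>exp (- 1 / x)\<close>.  With the denominators \<open>x ^ n\<close> the family is closed
  under differentiation, which turns smoothness into an induction.\<close>

definition flat :: "nat \<Rightarrow> real \<Rightarrow> real" where
  "flat n x = (if x > 0 then exp (- 1 / x) / x ^ n else 0)"

lemma flat_tendsto_0: "(flat n \<longlongrightarrow> 0) (at 0)"
proof -
  have "((\<lambda>x. inverse x ^ n / exp (inverse x)) \<longlongrightarrow> 0) (at_right (0::real))"
    by (rule filterlim_compose[OF tendsto_power_div_exp_0 filterlim_inverse_at_top_right])
  moreover have "\<forall>\<^sub>F x in at_right 0. inverse x ^ n / exp (inverse x) = flat n x"
    using eventually_at_right_less[of 0]
    by (rule eventually_mono) (simp add: flat_def exp_minus divide_simps)
  ultimately have "(flat n \<longlongrightarrow> 0) (at_right 0)"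
    by (rule Lim_transform_eventually)
  moreover have "(flat n \<longlongrightarrow> 0) (at_left 0)"
    by (rule Lim_transform_eventually[OF tendsto_const])
       (auto simp: flat_def eventually_at_left_field intro!: exI[of _ "-1"])
  ultimately show ?thesis by (simp add: filterlim_split_at)
qed

lemma flat_has_derivative:
  "(flat n has_real_derivative (flat (n + 2) x - real n * flat (n + 1) x)) (at x)"
proof -
  consider "x > 0" | "x < 0" | "x = 0" by linarith
  then show ?thesis
  proof cases
    case 1
    have "((\<lambda>x. exp (- 1 / x) / x ^ n) has_real_derivative
        ((exp (- 1 / x) * (1 / x\<^sup>2)) * x ^ n - exp (- 1 / x) * (real n * x ^ (n - 1))) / (x ^ n * x ^ n)) (at x)"
      using 1 by (auto intro!: derivative_eq_intros simp: power2_eq_square)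
    moreover have "real n * x ^ (n - 1) = real n * x ^ n / x"
      using 1 by (cases n) auto
    then have "((exp (- 1 / x) * (1 / x\<^sup>2)) * x ^ n - exp (- 1 / x) * (real n * x ^ (n - 1))) / (x ^ n * x ^ n)
        = flat (n + 2) x - real n * flat (n + 1) x"
      using 1 by (simp only:) (simp add: flat_def field_simps power2_eq_square)
    ultimately have "((\<lambda>x. exp (- 1 / x) / x ^ n) has_real_derivative
        (flat (n + 2) x - real n * flat (n + 1) x)) (at x)" by (simp only:)
    then show ?thesis
      by (rule has_field_derivative_transform_within_open[of _ _ _ "{0<..}"]) (use 1 in \<open>auto simp: flat_def\<close>)
  next
    case 2
    have "((\<lambda>x. 0) has_real_derivative (flat (n + 2) x - real n * flat (n + 1) x)) (at x)"
      using 2 by (auto simp: flat_def)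
    then show ?thesis
      by (rule has_field_derivative_transform_within_open[of _ _ _ "{..<0}"]) (use 2 in \<open>auto simp: flat_def\<close>)
  next
    case 3
    have "((\<lambda>h. (flat n (0 + h) - flat n 0) / h) \<longlongrightarrow> 0) (at 0)"
      by (rule Lim_transform_eventually[OF flat_tendsto_0[of "Suc n"]])
         (auto simp: flat_def divide_simps intro!: always_eventually)
    then show ?thesis using 3 by (simp add: DERIV_def flat_def)
  qed
qed

lemma k_smooth_on_flat: "k_smooth_on k UNIV (flat n)"
proof (induction k arbitrary: n)
  case 0
  then show ?case using flat_has_derivative
    by (auto intro!: continuous_at_imp_continuous_on DERIV_isCont)
next
  case (Suc k)
  let ?f' = "\<lambda>x v. (flat (n + 2) x + - real n * flat (n + 1) x) * v"
  have "\<forall>x\<in>UNIV. (flat n has_derivative ?f' x) (at x)"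
    using flat_has_derivative[of n] by (simp add: has_field_derivative_def)
  moreover have "\<forall>v. k_smooth_on k UNIV (\<lambda>x. ?f' x v)"
    by (intro allI bounded_bilinear.k_smooth_on_prod[OF bounded_bilinear_mult]
              k_smooth_on_add k_smooth_on_const Suc)
  ultimately show ?case unfolding k_smooth_on.simps by (intro exI[of _ ?f'] conjI)
qed

section \<open>Compactness of balls in the model space\<close>

lemma compact_bounded_combinations:
  fixes C :: "'e::real_normed_vector set"
  assumes "finite C"
  shows "compact {\<Sum>c\<in>C. t c *\<^sub>R c | t. \<forall>c\<in>C. \<bar>t c\<bar> \<le> R c}"
  using assms
proof (induction C)
  case empty
  then show ?case by simp
next
  case (insert b C)
  let ?S = "\<lambda>C. {\<Sum>c\<in>C. t c *\<^sub>R c | t. \<forall>c\<in>C. \<bar>t c\<bar> \<le> R c}"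
  have "?S (insert b C) = {x + y | x y. x \<in> (\<lambda>r. r *\<^sub>R b) ` {- R b..R b} \<and> y \<in> ?S C}"
  proof (intro equalityI subsetI)
    fix x assume "x \<in> ?S (insert b C)"
    then obtain t where t: "x = (\<Sum>c\<in>insert b C. t c *\<^sub>R c)" "\<forall>c\<in>insert b C. \<bar>t c\<bar> \<le> R c" by blast
    then have "x = t b *\<^sub>R b + (\<Sum>c\<in>C. t c *\<^sub>R c)" using insert.hyps by simp
    moreover have "t b *\<^sub>R b \<in> (\<lambda>r. r *\<^sub>R b) ` {- R b..R b}"
      using t(2) by (intro imageI) (simp add: abs_le_iff minus_le_iff)
    moreover have "(\<Sum>c\<in>C. t c *\<^sub>R c) \<in> ?S C" using t(2) by (intro CollectI exI conjI) auto
    ultimately show "x \<in> {x + y | x y. x \<in> (\<lambda>r. r *\<^sub>R b) ` {- R b..R b} \<and> y \<in> ?S C}"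
      by - (rule CollectI, rule exI, rule exI, rule conjI, assumption, rule conjI)
  next
    fix x assume "x \<in> {x + y | x y. x \<in> (\<lambda>r. r *\<^sub>R b) ` {- R b..R b} \<and> y \<in> ?S C}"
    then obtain r t where rt: "x = r *\<^sub>R b + (\<Sum>c\<in>C. t c *\<^sub>R c)" "\<bar>r\<bar> \<le> R b" "\<forall>c\<in>C. \<bar>t c\<bar> \<le> R c"
      by auto
    have "(\<Sum>c\<in>C. (t(b := r)) c *\<^sub>R c) = (\<Sum>c\<in>C. t c *\<^sub>R c)"
      by (rule sum.cong) (use insert.hyps in auto)
    then have "x = (\<Sum>c\<in>insert b C. (t(b := r)) c *\<^sub>R c)" using rt insert.hyps by simp
    then show "x \<in> ?S (insert b C)" using rt by (auto intro!: exI[of _ "t(b := r)"])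
  qed
  moreover have "compact ((\<lambda>r. r *\<^sub>R b) ` {- R b..R b})"
    by (intro compact_continuous_image continuous_intros compact_Icc)
  ultimately show ?case by (simp only: compact_sums[OF _ insert.IH])
qed

text \<open>Gram--Schmidt gives an orthogonal spanning set, and in the corresponding coordinates
  a ball lies in the image of a box, which is a finite sum of compact segments.\<close>

lemma compact_cball_finite_span:
  fixes a :: "'e::real_inner"
  assumes "finite B" "span B = (UNIV :: 'e set)"
  shows "compact (cball a r)"
proof -
  obtain C where C: "finite C" "span C = (UNIV :: 'e set)" "pairwise orthogonal C"
    using basis_orthogonal[OF assms(1)] assms(2) by metis
  have expand: "x = (\<Sum>c\<in>C. ((x \<bullet> c) / (c \<bullet> c)) *\<^sub>R c)" for x
  proof -
    let ?y = "x - (\<Sum>c\<in>C. ((x \<bullet> c) / (c \<bullet> c)) *\<^sub>R c)"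
    have "orthogonal ?y d" if d: "d \<in> C" for d
    proof -
      have "(\<Sum>c\<in>C. ((x \<bullet> c) / (c \<bullet> c)) * (c \<bullet> d)) = (\<Sum>c\<in>C. if c = d then x \<bullet> d else 0)"
        using C(3) d by (intro sum.cong) (auto simp: pairwise_def orthogonal_def)
      then show ?thesis using C(1) d
        by (simp add: orthogonal_def inner_diff_left inner_sum_left)
    qed
    then have "orthogonal ?y ?y"
      using orthogonal_to_span[of ?y C ?y] C(2) by auto
    then show ?thesis by (simp add: orthogonal_self)
  qed
  let ?K = "{\<Sum>c\<in>C. t c *\<^sub>R c | t. \<forall>c\<in>C. \<bar>t c\<bar> \<le> (norm a + \<bar>r\<bar>) / norm c}"
  have "cball a r \<subseteq> ?K"
  proof
    fix x assume "x \<in> cball a r"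
    then have "norm (x - a) \<le> r" by (simp add: dist_norm norm_minus_commute)
    then have x: "norm x \<le> norm a + \<bar>r\<bar>" using norm_triangle_sub[of x a] by simp
    have "\<bar>(x \<bullet> c) / (c \<bullet> c)\<bar> \<le> (norm a + \<bar>r\<bar>) / norm c" for c
    proof (cases "c = 0")
      case False
      have "\<bar>x \<bullet> c\<bar> \<le> (norm a + \<bar>r\<bar>) * norm c"
        using Cauchy_Schwarz_ineq2[of x c] x by (meson mult_right_mono norm_ge_zero order_trans)
      then show ?thesis using False
        by (simp add: dot_square_norm power2_eq_square divide_simps)
    qed simp
    with expand[of x] show "x \<in> ?K"
      by (auto intro!: exI[of _ "\<lambda>c. (x \<bullet> c) / (c \<bullet> c)"])
  qed
  then have "?K \<inter> cball a r = cball a r" by (rule Int_absorb1)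
  with compact_Int_closed[OF compact_bounded_combinations[OF C(1), of "\<lambda>c. (norm a + \<bar>r\<bar>) / norm c"] closed_cball[of a r]]
  show ?thesis by (simp only:)
qed

section \<open>Smooth functions on a manifold\<close>

locale manifold =
  fixes M :: "('m::{t2_space,second_countable_topology}, 'e::real_inner) atlas"
  assumes smooth_manifold: "smooth_manifold M"
begin

lemma chart:
  assumes "(W, \<phi>) \<in> M"
  shows "open W" "open (\<phi> ` W)" "homeomorphism W (\<phi> ` W) \<phi> (inv_into W \<phi>)"
    and "\<And>q. q \<in> W \<Longrightarrow> inv_into W \<phi> (\<phi> q) = q"
proof -
  show "open W" "open (\<phi> ` W)" and h: "homeomorphism W (\<phi> ` W) \<phi> (inv_into W \<phi>)"
    using assms smooth_manifold by (auto simp: smooth_manifold_def)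
  show "inv_into W \<phi> (\<phi> q) = q" if "q \<in> W" for q
    using h that by (simp add: homeomorphism_def)
qed

lemma chart_exists: obtains W \<phi> where "(W, \<phi>) \<in> M" "p \<in> W"
  using smooth_manifold by (force simp: smooth_manifold_def)

lemma chart_image_open:
  assumes "(W, \<phi>) \<in> M" "open V"
  shows "open (\<phi> ` (W \<inter> V))"
proof -
  have "\<phi> ` (W \<inter> V) = \<phi> ` W \<inter> inv_into W \<phi> -` V"
    using chart(4)[OF assms(1)] by force
  then show ?thesis
    using chart(2,3)[OF assms(1)] assms(2)
    by (simp add: homeomorphism_def continuous_open_preimage)
qed

lemma smooth_fun_on_iff:
  "smooth_fun_on M V f \<longleftrightarrow>
     (\<forall>k W \<phi>. (W, \<phi>) \<in> M \<longrightarrow> k_smooth_on k (\<phi> ` (W \<inter> V)) (\<lambda>y. f (inv_into W \<phi> y)))"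
  by (auto simp: smooth_fun_on_def smooth_on_def comp_def)

lemma smooth_fun_on_subset: "smooth_fun_on M V f \<Longrightarrow> V' \<subseteq> V \<Longrightarrow> smooth_fun_on M V' f"
  unfolding smooth_fun_on_iff by (meson Int_mono image_mono k_smooth_on_subset order_refl)

lemma smooth_fun_on_cong:
  assumes "open V" "smooth_fun_on M V f" "\<And>q. q \<in> V \<Longrightarrow> f q = g q"
  shows "smooth_fun_on M V g"
  unfolding smooth_fun_on_iff
proof (intro allI impI)
  fix k W \<phi> assume W: "(W, \<phi>) \<in> M"
  have "k_smooth_on k (\<phi> ` (W \<inter> V)) (\<lambda>y. f (inv_into W \<phi> y))"
    using assms(2) W by (simp add: smooth_fun_on_iff)
  then show "k_smooth_on k (\<phi> ` (W \<inter> V)) (\<lambda>y. g (inv_into W \<phi> y))"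
    by (rule k_smooth_on_cong[OF chart_image_open[OF W assms(1)]]) (use chart(4)[OF W] assms(3) in auto)
qed

lemma smooth_fun_on_local:
  assumes "\<And>p. p \<in> V \<Longrightarrow> \<exists>O'. open O' \<and> p \<in> O' \<and> smooth_fun_on M O' f"
  shows "smooth_fun_on M V f"
  unfolding smooth_fun_on_iff
proof (intro allI impI k_smooth_on_local)
  fix k W \<phi> y assume W: "(W, \<phi>) \<in> M" and "y \<in> \<phi> ` (W \<inter> V)"
  then obtain p where p: "y = \<phi> p" "p \<in> W" "p \<in> V" by auto
  obtain O' where "open O'" "p \<in> O'" "smooth_fun_on M O' f" using assms p(3) by blast
  with W p show "\<exists>T. open T \<and> y \<in> T \<and> k_smooth_on k T (\<lambda>y. f (inv_into W \<phi> y))"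
    by (intro exI[of _ "\<phi> ` (W \<inter> O')"]) (auto simp: smooth_fun_on_iff chart_image_open)
qed

lemma smooth_fun_on_const: "smooth_fun_on M V (\<lambda>q. c)"
  by (simp add: smooth_fun_on_iff k_smooth_on_const)

lemma smooth_fun_on_add:
  "smooth_fun_on M V f \<Longrightarrow> smooth_fun_on M V g \<Longrightarrow> smooth_fun_on M V (\<lambda>q. f q + g q)"
  by (simp add: smooth_fun_on_iff k_smooth_on_add)

lemma smooth_fun_on_mult:
  "smooth_fun_on M V f \<Longrightarrow> smooth_fun_on M V g \<Longrightarrow> smooth_fun_on M V (\<lambda>q. f q * g q)"
  by (simp add: smooth_fun_on_iff bounded_bilinear.k_smooth_on_prod[OF bounded_bilinear_mult])

lemma smooth_fun_on_compose_real:
  "(\<And>k. k_smooth_on k UNIV h) \<Longrightarrow> smooth_fun_on M V g \<Longrightarrow> smooth_fun_on M V (\<lambda>q. h (g q))"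
  by (simp add: smooth_fun_on_iff k_smooth_on_compose_real[of _ h])

lemma smooth_fun_on_sum:
  "(\<And>i. i \<in> I \<Longrightarrow> smooth_fun_on M V (f i)) \<Longrightarrow> smooth_fun_on M V (\<lambda>q. \<Sum>i\<in>I. f i q)"
  by (induction I rule: infinite_finite_induct) (auto intro: smooth_fun_on_const smooth_fun_on_add)

lemma smooth_fun_on_chart_inner:
  assumes W: "(W, \<phi>) \<in> M"
  shows "smooth_fun_on M W (\<lambda>q. (\<phi> q - a) \<bullet> w)" "smooth_fun_on M W (\<lambda>q. (\<phi> q - a) \<bullet> (\<phi> q - a))"
proof -
  have "k_smooth_on k (\<psi> ` (V \<inter> W)) (\<lambda>y. \<phi> (inv_into V \<psi> y) - a)" if "(V, \<psi>) \<in> M" for k V \<psi>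
  proof -
    have "smooth_on (\<psi> ` (V \<inter> W)) (\<phi> \<circ> inv_into V \<psi>)"
      using smooth_manifold W that by (fastforce simp: smooth_manifold_def)
    then have "k_smooth_on k (\<psi> ` (V \<inter> W)) (\<lambda>y. \<phi> (inv_into V \<psi> y) + - a)"
      by (intro k_smooth_on_add k_smooth_on_const) (simp add: smooth_on_def comp_def)
    then show ?thesis by simp
  qed
  then show "smooth_fun_on M W (\<lambda>q. (\<phi> q - a) \<bullet> w)" "smooth_fun_on M W (\<lambda>q. (\<phi> q - a) \<bullet> (\<phi> q - a))"
    unfolding smooth_fun_on_iff
    by (auto intro!: bounded_bilinear.k_smooth_on_prod[OF bounded_bilinear_inner] k_smooth_on_const)
qed

lemma smooth_fun_on_extend_zero:
  assumes "open W" "closed K" "K \<subseteq> W" "smooth_fun_on M W g" "\<And>q. q \<in> W \<Longrightarrow> q \<notin> K \<Longrightarrow> g q = 0"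
  shows "smooth_fun_on M UNIV (\<lambda>q. if q \<in> W then g q else 0)" (is "smooth_fun_on M UNIV ?f")
proof (rule smooth_fun_on_local)
  fix p
  have "smooth_fun_on M W ?f"
    by (rule smooth_fun_on_cong[OF assms(1,4)]) simp
  moreover have "smooth_fun_on M (- K) ?f"
    by (rule smooth_fun_on_cong[OF _ smooth_fun_on_const[of _ 0]]) (use assms in auto)
  moreover have "open (- K)" using assms(2) by auto
  ultimately show "\<exists>O'. open O' \<and> p \<in> O' \<and> smooth_fun_on M O' ?f"
    using assms(1,3) by (cases "p \<in> W") auto
qed

text \<open>Take \<open>flat (r\<^sup>2 - |\<phi> q - \<phi> p|\<^sup>2)\<close> in a chart.  Its support lies in the preimage of a closed ball;
  as the ball is compact and the manifold is Hausdorff, this preimage is closed in the whole manifold.\<close>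

lemma bump_function_exists:
  assumes "open N" "p \<in> N"
  obtains \<eta> K where "smooth_fun_on M UNIV \<eta>" "closed K" "K \<subseteq> N" "\<And>q. q \<notin> K \<Longrightarrow> \<eta> q = 0" "\<eta> p = 1"
proof -
  obtain W \<phi> where W: "(W, \<phi>) \<in> M" "p \<in> W" by (rule chart_exists)
  have "open (\<phi> ` (W \<inter> N))" "\<phi> p \<in> \<phi> ` (W \<inter> N)"
    using chart_image_open[OF W(1) assms(1)] W(2) assms(2) by auto
  then obtain r where r: "r > 0" "cball (\<phi> p) r \<subseteq> \<phi> ` (W \<inter> N)"
    using open_contains_cball by blast
  define K where "K = inv_into W \<phi> ` cball (\<phi> p) r"
  obtain bs :: "'e list" where "is_basis UNIV bs"
    using smooth_manifold by (auto simp: smooth_manifold_def)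
  then have "compact (cball (\<phi> p) r)"
    by (intro compact_cball_finite_span[of "set bs"]) (auto simp: is_basis_def)
  moreover have "continuous_on (cball (\<phi> p) r) (inv_into W \<phi>)"
    using chart(3)[OF W(1)] r(2)
    by (auto simp: homeomorphism_def intro: continuous_on_subset[of "\<phi> ` W"])
  ultimately have "closed K"
    unfolding K_def by (intro compact_imp_closed compact_continuous_image)
  have K: "K \<subseteq> W \<inter> N" using r(2) chart(4)[OF W(1)] by (force simp: K_def)
  \<comment> \<open>The last factor normalises the value at \<open>p\<close> to 1.\<close>
  define g where "g q = flat 0 (r\<^sup>2 + -1 * ((\<phi> q - \<phi> p) \<bullet> (\<phi> q - \<phi> p))) * inverse (flat 0 (r\<^sup>2))" for q
  have "smooth_fun_on M W g"
    unfolding g_def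
    by (intro smooth_fun_on_mult smooth_fun_on_compose_real[of "flat 0"] smooth_fun_on_add
              smooth_fun_on_const smooth_fun_on_chart_inner(2)[OF W(1)] k_smooth_on_flat)
  moreover have "g q = 0" if "q \<in> W" "q \<notin> K" for q
  proof -
    have "\<phi> q \<notin> cball (\<phi> p) r"
      using that chart(4)[OF W(1) that(1)] by (metis K_def imageI)
    then have "r < norm (\<phi> q - \<phi> p)" by (simp add: dist_norm norm_minus_commute)
    then have "r\<^sup>2 < (norm (\<phi> q - \<phi> p))\<^sup>2" using r(1) by (intro power_strict_mono) auto
    then show ?thesis by (simp add: g_def flat_def dot_square_norm)
  qed
  ultimately have "smooth_fun_on M UNIV (\<lambda>q. if q \<in> W then g q else 0)"
    using smooth_fun_on_extend_zero[OF chart(1)[OF W(1)] \<open>closed K\<close>] K by blast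
  moreover have "g p = 1" using r(1) by (simp add: g_def flat_def)
  moreover have "(if q \<in> W then g q else 0) = 0" if "q \<notin> K" for q
    using that \<open>\<And>q. q \<in> W \<Longrightarrow> q \<notin> K \<Longrightarrow> g q = 0\<close> by simp
  ultimately show thesis
    using that[of "\<lambda>q. if q \<in> W then g q else 0" K] \<open>closed K\<close> K W(2) by simp
qed

text \<open>The function is \<open>(\<phi> q - \<phi> p) \<bullet> w\<close> cut off by a bump.  The cut-off keeps the derivative at \<open>p\<close>,
  because the bump has value 1 there and its derivative is multiplied by \<open>\<phi> p - \<phi> p = 0\<close>.\<close>

lemma smooth_fun_with_derivative:
  assumes W: "(W, \<phi>) \<in> M" "p \<in> W"
  obtains f where "smooth_fun_on M UNIV f" "\<And>b. coord_vector M (W, \<phi>) b p f = b \<bullet> w"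
proof -
  obtain \<eta> K where \<eta>: "smooth_fun_on M UNIV \<eta>" "closed K" "K \<subseteq> W" "\<And>q. q \<notin> K \<Longrightarrow> \<eta> q = 0" "\<eta> p = 1"
    using bump_function_exists[OF chart(1)[OF W(1)] W(2)] by metis
  define f where "f q = (if q \<in> W then \<eta> q * ((\<phi> q - \<phi> p) \<bullet> w) else 0)" for q
  have f: "smooth_fun_on M UNIV f"
    unfolding f_def
    by (rule smooth_fun_on_extend_zero[OF chart(1)[OF W(1)] \<eta>(2,3)])
       (use \<eta> in \<open>auto intro!: smooth_fun_on_mult smooth_fun_on_chart_inner[OF W(1)]
                        intro: smooth_fun_on_subset[of UNIV]\<close>)
  have \<phi>p: "\<phi> p \<in> \<phi> ` W" using W by auto
  have "k_smooth_on (Suc 0) (\<phi> ` W) (\<lambda>y. \<eta> (inv_into W \<phi> y))"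
    using \<eta>(1) W(1) by (simp only: smooth_fun_on_iff) (metis Int_UNIV_right)
  then obtain D where "((\<lambda>y. \<eta> (inv_into W \<phi> y)) has_derivative D) (at (\<phi> p))"
    using \<phi>p by auto
  then have "((\<lambda>y. \<eta> (inv_into W \<phi> y) * ((y - \<phi> p) \<bullet> w)) has_derivative (\<lambda>b. b \<bullet> w)) (at (\<phi> p))"
    by (auto intro!: derivative_eq_intros simp: chart(4)[OF W] \<eta>(5))
  then have "((f \<circ> inv_into W \<phi>) has_derivative (\<lambda>b. b \<bullet> w)) (at (\<phi> p))"
    by (rule has_derivative_transform_within_open[OF _ chart(2)[OF W(1)] \<phi>p])
       (use chart(4)[OF W(1)] in \<open>auto simp: f_def\<close>)
  then have "frechet_derivative (f \<circ> inv_into W \<phi>) (at (\<phi> p)) = (\<lambda>b. b \<bullet> w)"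
    by (metis frechet_derivative_at)
  then show thesis using that[of f] f by (simp add: coord_vector_def)
qed

end

section \<open>Sections and bundle morphisms\<close>

lemma bij_betw_nth_set: "distinct vs \<Longrightarrow> bij_betw ((!) vs) {..<length vs} (set vs)"
  by (rule bij_betw_nth) auto

lemma is_basis_coeffs_zero:
  assumes "is_basis S vs" "(\<Sum>i<length vs. c i *\<^sub>R vs ! i) = 0" "i < length vs"
  shows "c i = 0"
proof -
  have vs: "distinct vs" "independent (set vs)" using assms(1) by (auto simp: is_basis_def)
  let ?inv = "the_inv_into {..<length vs} ((!) vs)"
  have inv: "?inv (vs ! j) = j" if "j < length vs" for j
    using bij_betw_nth_set[OF vs(1)] that by (simp add: bij_betw_def the_inv_into_f_f)
  have "(\<Sum>v\<in>set vs. c (?inv v) *\<^sub>R v) = (\<Sum>i<length vs. c (?inv (vs ! i)) *\<^sub>R vs ! i)"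
    by (rule sum.reindex_bij_betw[OF bij_betw_nth_set[OF vs(1)], symmetric])
  also have "\<dots> = 0" using assms(2) inv by simp
  finally have "c (?inv (vs ! i)) = 0"
    using independentD[OF vs(2) finite_set order_refl, of "\<lambda>v. c (?inv v)" "vs ! i"] assms(3) by simp
  with inv[OF assms(3)] show ?thesis by simp
qed

lemma is_basis_expand:
  assumes "is_basis S vs" "v \<in> S"
  obtains c where "v = (\<Sum>i<length vs. c i *\<^sub>R vs ! i)"
proof -
  have "v \<in> span (set vs)" "distinct vs" using assms by (auto simp: is_basis_def)
  then obtain u where "v = (\<Sum>w\<in>set vs. u w *\<^sub>R w)"
    unfolding span_finite[OF finite_set] by blast
  also have "\<dots> = (\<Sum>i<length vs. u (vs ! i) *\<^sub>R vs ! i)"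
    by (rule sum.reindex_bij_betw[OF bij_betw_nth_set[OF \<open>distinct vs\<close>], symmetric])
  finally show thesis by (rule that)
qed

lemma linear_between_zero: "linear_between S T h \<Longrightarrow> subspace S \<Longrightarrow> h 0 = 0"
  using subspace_0[of S] unfolding linear_between_def by (metis scaleR_zero_left)

lemma linear_between_sum:
  assumes "linear_between S T h" "subspace S" "\<And>i. i \<in> I \<Longrightarrow> v i \<in> S"
  shows "h (\<Sum>i\<in>I. c i *\<^sub>R v i) = (\<Sum>i\<in>I. c i *\<^sub>R h (v i))"
  using assms(3)
proof (induction I rule: infinite_finite_induct)
  case (insert j I)
  have "c j *\<^sub>R v j \<in> S" "(\<Sum>i\<in>I. c i *\<^sub>R v i) \<in> S"
    using insert.prems assms(2) by (auto intro!: subspace_scale subspace_sum)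
  then have "h (c j *\<^sub>R v j + (\<Sum>i\<in>I. c i *\<^sub>R v i)) = h (c j *\<^sub>R v j) + h (\<Sum>i\<in>I. c i *\<^sub>R v i)"
    using assms(1) unfolding linear_between_def by blast
  moreover have "h (c j *\<^sub>R v j) = c j *\<^sub>R h (v j)"
    using assms(1) insert.prems[of j] unfolding linear_between_def by blast
  moreover have "h (\<Sum>i\<in>I. c i *\<^sub>R v i) = (\<Sum>i\<in>I. c i *\<^sub>R h (v i))"
    by (rule insert.IH) (simp add: insert.prems)
  ultimately show ?case using insert.hyps by simp
qed (simp_all add: linear_between_zero[OF assms(1,2)])

text \<open>Uniqueness of the coefficients with respect to a frame, without existence.  This is the property of the target
  of a bundle morphism by which local sections are glued; for the tangent bundle it is the linear
  independence of coordinate vectors.\<close>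

definition free_frames :: "('m::topological_space, 'v::real_vector, 'z) vbundle_scheme \<Rightarrow> bool" where
  "free_frames E \<longleftrightarrow> (\<forall>p. subspace (fibre E p)) \<and>
     (\<forall>(W, es)\<in>frames E. open W \<and> (\<forall>p\<in>W. \<forall>c. (\<Sum>i<length es. c i *\<^sub>R (es ! i) p) = 0 \<longrightarrow>
        (\<forall>i<length es. c i = 0)))"

lemma free_frames_coeffs_eq:
  assumes "free_frames E" "(W, es) \<in> frames E" "p \<in> W" "i < length es"
    and "(\<Sum>i<length es. c i *\<^sub>R (es ! i) p) = (\<Sum>i<length es. d i *\<^sub>R (es ! i) p)"
  shows "c i = d i"
proof -
  have zero: "(\<Sum>i<length es. (c i - d i) *\<^sub>R (es ! i) p) = 0"
    using assms(5) by (simp add: scaleR_diff_left sum_subtractf)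
  have "\<forall>p\<in>W. \<forall>c. (\<Sum>i<length es. c i *\<^sub>R (es ! i) p) = 0 \<longrightarrow> (\<forall>i<length es. c i = 0)"
    using bspec[OF conjunct2[OF assms(1)[unfolded free_frames_def]] assms(2)] by simp
  from this[rule_format, OF assms(3) zero assms(4)] show ?thesis by simp
qed

lemma vector_bundle_frame:
  assumes "vector_bundle M E" "(W, es) \<in> frames E"
  shows "open W" "\<And>p. p \<in> W \<Longrightarrow> is_basis (fibre E p) (map (\<lambda>e. e p) es)"
    and "\<And>e. e \<in> set es \<Longrightarrow> smooth_section_on M E W e"
    and "\<And>p e. p \<in> W \<Longrightarrow> e \<in> set es \<Longrightarrow> e p \<in> fibre E p"
proof -
  have *: "open W \<and> (\<forall>p\<in>W. is_basis (fibre E p) (map (\<lambda>e. e p) es)) \<and>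
      (\<forall>e\<in>set es. smooth_section_on M E W e)"
    using assms unfolding vector_bundle_def by blast
  then show "open W" "\<And>p. p \<in> W \<Longrightarrow> is_basis (fibre E p) (map (\<lambda>e. e p) es)"
    "\<And>e. e \<in> set es \<Longrightarrow> smooth_section_on M E W e"
    "\<And>p e. p \<in> W \<Longrightarrow> e \<in> set es \<Longrightarrow> e p \<in> fibre E p"
    by (simp_all add: smooth_section_on_def)
qed

lemma vector_bundle_frame_exists:
  assumes "vector_bundle M E"
  obtains W es where "(W, es) \<in> frames E" "p \<in> W"
proof -
  have "p \<in> (\<Union>(W, es)\<in>frames E. W)" using assms by (simp add: vector_bundle_def)
  then show thesis using that by auto
qed

lemma vector_bundle_subspace: "vector_bundle M E \<Longrightarrow> subspace (fibre E p)"
  by (simp add: vector_bundle_def)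

lemma vector_bundle_free_frames:
  assumes "vector_bundle M E"
  shows "free_frames E"
proof -
  have "c i = 0" if "(W, es) \<in> frames E" "p \<in> W" "(\<Sum>i<length es. c i *\<^sub>R (es ! i) p) = 0" "i < length es"
    for W es p c i
    using is_basis_coeffs_zero[OF vector_bundle_frame(2)[OF assms that(1,2)], of c i] that(3,4) by simp
  then show ?thesis
    using vector_bundle_frame(1)[OF assms] vector_bundle_subspace[OF assms]
    unfolding free_frames_def by blast
qed

lemma subspace_tangent_space: "subspace (tangent_space M p)"
  by (auto simp: subspace_def tangent_space_def linear_between_def scaleR_fun_def algebra_simps)

lemma smooth_section_on_fibre: "smooth_section_on M E V s \<Longrightarrow> p \<in> V \<Longrightarrow> s p \<in> fibre E p"
  by (simp add: smooth_section_on_def)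

lemma sections_fibre: "s \<in> sections M E \<Longrightarrow> s p \<in> fibre E p"
  by (simp add: sections_def smooth_section_on_def)

lemma smooth_section_on_coeffs:
  assumes "smooth_section_on M E V s" "(W, es) \<in> frames E"
  obtains c where "\<And>i. i < length es \<Longrightarrow> smooth_fun_on M (W \<inter> V) (c i)"
    and "\<And>p. p \<in> W \<Longrightarrow> p \<in> V \<Longrightarrow> s p = (\<Sum>i<length es. c i p *\<^sub>R (es ! i) p)"
proof -
  have "\<exists>c. (\<forall>i<length es. smooth_fun_on M (W \<inter> V) (c i)) \<and>
      (\<forall>p\<in>W \<inter> V. s p = (\<Sum>i<length es. c i p *\<^sub>R (es ! i) p))"
    using assms unfolding smooth_section_on_def by blast
  then show thesis using that by blast
qed

lemma smooth_section_onI: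
  assumes "\<And>p. p \<in> V \<Longrightarrow> s p \<in> fibre E p"
    and "\<And>W es. (W, es) \<in> frames E \<Longrightarrow> \<exists>c. (\<forall>i<length es. smooth_fun_on M (W \<inter> V) (c i)) \<and>
           (\<forall>p\<in>W \<inter> V. s p = (\<Sum>i<length es. c i p *\<^sub>R (es ! i) p))"
  shows "smooth_section_on M E V s"
  unfolding smooth_section_on_def
proof (intro conjI ballI)
  fix x assume "x \<in> frames E"
  then show "case x of (W, es) \<Rightarrow> \<exists>c. (\<forall>i<length es. smooth_fun_on M (W \<inter> V) (c i)) \<and>
      (\<forall>p\<in>W \<inter> V. s p = (\<Sum>i<length es. c i p *\<^sub>R (es ! i) p))"
    using assms(2)[of "fst x" "snd x"] by (simp add: case_prod_unfold)
qed (rule assms(1))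

lemma smooth_section_on_cong:
  "smooth_section_on M E V s \<Longrightarrow> (\<And>p. p \<in> V \<Longrightarrow> s p = t p) \<Longrightarrow> smooth_section_on M E V t"
  by (simp add: smooth_section_on_def)

context manifold
begin

text \<open>Apply a vanishing combination of the coordinate vectors to a function whose derivative is the pairing with the
  same combination \<open>w\<close> of the basis vectors: the result is \<open>w \<bullet> w = 0\<close>.\<close>

lemma coord_vector_coeffs_zero:
  assumes W: "(W, \<phi>) \<in> M" "p \<in> W" and bs: "is_basis UNIV bs"
    and zero: "(\<Sum>i<length bs. c i *\<^sub>R coord_vector M (W, \<phi>) (bs ! i) p) = 0" and "i < length bs"
  shows "c i = 0"
proof -
  define w where "w = (\<Sum>i<length bs. c i *\<^sub>R bs ! i)"
  obtain f where f: "\<And>b. coord_vector M (W, \<phi>) b p f = b \<bullet> w"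
    using smooth_fun_with_derivative[OF W, where w = w] by metis
  have eval: "(\<Sum>i\<in>I. c i *\<^sub>R X i) f = (\<Sum>i\<in>I. c i * X i f)" for I :: "nat set" and X :: "nat \<Rightarrow> 'm tvec"
    by (induction I rule: infinite_finite_induct) (auto simp: scaleR_fun_def)
  have "(\<Sum>i<length bs. c i *\<^sub>R coord_vector M (W, \<phi>) (bs ! i) p) f = (\<Sum>i<length bs. c i * (bs ! i \<bullet> w))"
    by (simp only: eval f)
  also have "\<dots> = w \<bullet> w"
    by (subst (2) w_def) (simp add: inner_sum_left)
  finally have "w = 0" using zero by simp
  then show ?thesis using is_basis_coeffs_zero[OF bs] assms(5) by (simp add: w_def)
qed

lemma free_frames_tangent_bundle: "free_frames (tangent_bundle M)"
  unfolding free_frames_def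
proof (intro conjI allI ballI)
  show "subspace (fibre (tangent_bundle M) p)" for p
    by (simp add: tangent_bundle_def subspace_tangent_space)
  fix x assume "x \<in> frames (tangent_bundle M)"
  then obtain W \<phi> and bs :: "'e list" where x: "x = (W, map (coord_vector M (W, \<phi>)) bs)"
    and W: "(W, \<phi>) \<in> M" and bs: "is_basis UNIV bs"
    by (auto simp: tangent_bundle_def)
  show "case x of (W, es) \<Rightarrow> open W \<and> (\<forall>p\<in>W. \<forall>c. (\<Sum>i<length es. c i *\<^sub>R (es ! i) p) = 0 \<longrightarrow>
      (\<forall>i<length es. c i = 0))"
    using chart(1)[OF W] coord_vector_coeffs_zero[OF W _ bs] by (simp add: x)
qed

lemma smooth_section_on_subset:
  assumes "smooth_section_on M E V s" "V' \<subseteq> V"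
  shows "smooth_section_on M E V' s"
proof (rule smooth_section_onI)
  show "s p \<in> fibre E p" if "p \<in> V'" for p
    using smooth_section_on_fibre[OF assms(1)] assms(2) that by blast
next
  fix W es assume "(W, es) \<in> frames E"
  then obtain c where "\<And>i. i < length es \<Longrightarrow> smooth_fun_on M (W \<inter> V) (c i)"
    "\<And>p. p \<in> W \<Longrightarrow> p \<in> V \<Longrightarrow> s p = (\<Sum>i<length es. c i p *\<^sub>R (es ! i) p)"
    using smooth_section_on_coeffs[OF assms(1)] by metis
  then show "\<exists>c. (\<forall>i<length es. smooth_fun_on M (W \<inter> V') (c i)) \<and>
      (\<forall>p\<in>W \<inter> V'. s p = (\<Sum>i<length es. c i p *\<^sub>R (es ! i) p))"
    using assms(2) by (intro exI[of _ c]) (auto intro: smooth_fun_on_subset[of "W \<inter> V"])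
qed

lemma smooth_section_on_zero:
  fixes E :: "('m, 'v::real_vector, 'z) vbundle_scheme"
  assumes "\<And>p. subspace (fibre E p)"
  shows "smooth_section_on M E V (\<lambda>p. 0)"
proof (rule smooth_section_onI)
  show "\<exists>c. (\<forall>i<length es. smooth_fun_on M (W \<inter> V) (c i)) \<and>
      (\<forall>p\<in>W \<inter> V. 0 = (\<Sum>i<length es. c i p *\<^sub>R (es ! i) p))" for W and es :: "('m \<Rightarrow> 'v) list"
    by (rule exI[of _ "\<lambda>i p. 0"]) (simp add: smooth_fun_on_const)
qed (rule subspace_0[OF assms])

lemma smooth_section_on_add:
  assumes "\<And>p. subspace (fibre E p)" "smooth_section_on M E V s" "smooth_section_on M E V t"
  shows "smooth_section_on M E V (\<lambda>p. s p + t p)"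
proof (rule smooth_section_onI)
  show "s p + t p \<in> fibre E p" if "p \<in> V" for p
    by (intro subspace_add[OF assms(1)] smooth_section_on_fibre[OF assms(2) that]
              smooth_section_on_fibre[OF assms(3) that])
next
  fix W es assume W: "(W, es) \<in> frames E"
  obtain c where "\<And>i. i < length es \<Longrightarrow> smooth_fun_on M (W \<inter> V) (c i)"
    "\<And>p. p \<in> W \<Longrightarrow> p \<in> V \<Longrightarrow> s p = (\<Sum>i<length es. c i p *\<^sub>R (es ! i) p)"
    using smooth_section_on_coeffs[OF assms(2) W] by metis
  moreover obtain d where "\<And>i. i < length es \<Longrightarrow> smooth_fun_on M (W \<inter> V) (d i)"
    "\<And>p. p \<in> W \<Longrightarrow> p \<in> V \<Longrightarrow> t p = (\<Sum>i<length es. d i p *\<^sub>R (es ! i) p)"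
    using smooth_section_on_coeffs[OF assms(3) W] by metis
  ultimately show "\<exists>c. (\<forall>i<length es. smooth_fun_on M (W \<inter> V) (c i)) \<and>
      (\<forall>p\<in>W \<inter> V. s p + t p = (\<Sum>i<length es. c i p *\<^sub>R (es ! i) p))"
    by (intro exI[of _ "\<lambda>i p. c i p + d i p"])
       (auto intro: smooth_fun_on_add simp: scaleR_add_left sum.distrib)
qed

lemma smooth_section_on_scale:
  assumes "\<And>p. subspace (fibre E p)" "smooth_fun_on M V f" "smooth_section_on M E V s"
  shows "smooth_section_on M E V (\<lambda>p. f p *\<^sub>R s p)"
proof (rule smooth_section_onI)
  show "f p *\<^sub>R s p \<in> fibre E p" if "p \<in> V" for p
    using assms(3) that by (intro subspace_scale[OF assms(1)]) (rule smooth_section_on_fibre)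
next
  fix W es assume W: "(W, es) \<in> frames E"
  obtain c where "\<And>i. i < length es \<Longrightarrow> smooth_fun_on M (W \<inter> V) (c i)"
    "\<And>p. p \<in> W \<Longrightarrow> p \<in> V \<Longrightarrow> s p = (\<Sum>i<length es. c i p *\<^sub>R (es ! i) p)"
    using smooth_section_on_coeffs[OF assms(3) W] by metis
  then show "\<exists>c. (\<forall>i<length es. smooth_fun_on M (W \<inter> V) (c i)) \<and>
      (\<forall>p\<in>W \<inter> V. f p *\<^sub>R s p = (\<Sum>i<length es. c i p *\<^sub>R (es ! i) p))"
    using assms(2)
    by (intro exI[of _ "\<lambda>i p. f p * c i p"])
       (auto intro!: smooth_fun_on_mult intro: smooth_fun_on_subset[of V] simp: scaleR_sum_right)
qed

lemma smooth_section_on_sum: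
  assumes "\<And>p. subspace (fibre E p)" "\<And>i. i \<in> I \<Longrightarrow> smooth_section_on M E V (s i)"
  shows "smooth_section_on M E V (\<lambda>p. \<Sum>i\<in>I. s i p)"
  using assms(2)
proof (induction I rule: infinite_finite_induct)
  case (insert i I)
  then show ?case using smooth_section_on_add[OF assms(1), of V "s i" "\<lambda>p. \<Sum>i\<in>I. s i p"] by simp
qed (simp_all add: smooth_section_on_zero[OF assms(1)])

text \<open>Sections are described by coefficient functions on the whole domain of each frame.
  The coefficients of locally given sections fit together because they are unique.\<close>

lemma smooth_section_on_local:
  assumes E: "free_frames E"
    and loc: "\<And>p. p \<in> V \<Longrightarrow> \<exists>N. open N \<and> p \<in> N \<and> N \<subseteq> V \<and> smooth_section_on M E N s"
  shows "smooth_section_on M E V s"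
proof (rule smooth_section_onI)
  show "s p \<in> fibre E p" if "p \<in> V" for p
    using loc[OF that] smooth_section_on_fibre by blast
next
  fix W es assume W: "(W, es) \<in> frames E"
  then have "open W" using E by (auto simp: free_frames_def)
  have "\<exists>c. s p = (\<Sum>i<length es. c i *\<^sub>R (es ! i) p)" if p: "p \<in> W \<inter> V" for p
  proof -
    obtain N where N: "p \<in> N" "smooth_section_on M E N s" using loc p by blast
    obtain c where "\<And>p. p \<in> W \<Longrightarrow> p \<in> N \<Longrightarrow> s p = (\<Sum>i<length es. c i p *\<^sub>R (es ! i) p)"
      using smooth_section_on_coeffs[OF N(2) W] by metis
    then have "s p = (\<Sum>i<length es. c i p *\<^sub>R (es ! i) p)" using p N(1) by simp
    then show ?thesis by (intro exI[of _ "\<lambda>i. c i p"])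
  qed
  then obtain C where C: "\<And>p. p \<in> W \<inter> V \<Longrightarrow> s p = (\<Sum>i<length es. C p i *\<^sub>R (es ! i) p)"
    by metis
  have "smooth_fun_on M (W \<inter> V) (\<lambda>p. C p i)" if i: "i < length es" for i
  proof (rule smooth_fun_on_local)
    fix p assume p: "p \<in> W \<inter> V"
    then obtain N where N: "open N" "p \<in> N" "N \<subseteq> V" "smooth_section_on M E N s" using loc by blast
    obtain c where c: "\<And>i. i < length es \<Longrightarrow> smooth_fun_on M (W \<inter> N) (c i)"
      "\<And>p. p \<in> W \<Longrightarrow> p \<in> N \<Longrightarrow> s p = (\<Sum>i<length es. c i p *\<^sub>R (es ! i) p)"
      using smooth_section_on_coeffs[OF N(4) W] by metis
    have "smooth_fun_on M (W \<inter> N) (\<lambda>p. C p i)"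
    proof (rule smooth_fun_on_cong[OF _ c(1)[OF i]])
      show "open (W \<inter> N)" using \<open>open W\<close> N(1) by (rule open_Int)
      fix q assume q: "q \<in> W \<inter> N"
      then have "(\<Sum>i<length es. c i q *\<^sub>R (es ! i) q) = (\<Sum>i<length es. C q i *\<^sub>R (es ! i) q)"
        using c(2)[of q] C[of q] N(3) by auto
      then show "c i q = C q i"
        using free_frames_coeffs_eq[OF E W _ i, of q "\<lambda>i. c i q" "C q"] q by blast
    qed
    then show "\<exists>O'. open O' \<and> p \<in> O' \<and> smooth_fun_on M O' (\<lambda>p. C p i)"
      using \<open>open W\<close> N(1,2) p by (intro exI[of _ "W \<inter> N"]) auto
  qed
  with C show "\<exists>c. (\<forall>i<length es. smooth_fun_on M (W \<inter> V) (c i)) \<and>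
      (\<forall>p\<in>W \<inter> V. s p = (\<Sum>i<length es. c i p *\<^sub>R (es ! i) p))"
    by (intro exI[of _ "\<lambda>i p. C p i"]) simp
qed

text \<open>Near each point expand \<open>s\<close> in a frame of \<open>E\<close>; the image is the combination of the images of the frame
  with the same smooth coefficients.\<close>

lemma vb_morphism_smooth_section:
  assumes E: "vector_bundle M E" and F: "free_frames F" and h: "vb_morphism M E F h"
    and "open V" and s: "smooth_section_on M E V s"
  shows "smooth_section_on M F V (\<lambda>p. h p (s p))"
proof (rule smooth_section_on_local[OF F])
  fix p assume "p \<in> V"
  obtain W es where W: "(W, es) \<in> frames E" "p \<in> W"
    using vector_bundle_frame_exists[OF E] by metis
  note frame = vector_bundle_frame[OF E W(1)]
  have sub: "\<And>q. subspace (fibre F q)" using F by (simp add: free_frames_def)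
  obtain c where c: "\<And>i. i < length es \<Longrightarrow> smooth_fun_on M (W \<inter> V) (c i)"
    "\<And>p. p \<in> W \<Longrightarrow> p \<in> V \<Longrightarrow> s p = (\<Sum>i<length es. c i p *\<^sub>R (es ! i) p)"
    using smooth_section_on_coeffs[OF s W(1)] by metis
  have "smooth_section_on M F (W \<inter> V) (\<lambda>q. \<Sum>i<length es. c i q *\<^sub>R h q ((es ! i) q))"
  proof (intro smooth_section_on_sum smooth_section_on_scale sub)
    fix i assume i: "i \<in> {..<length es}"
    then show "smooth_fun_on M (W \<inter> V) (c i)" using c(1) by simp
    have "smooth_section_on M F W (\<lambda>q. h q ((es ! i) q))"
      using h W(1) i by (fastforce simp: vb_morphism_def)
    then show "smooth_section_on M F (W \<inter> V) (\<lambda>q. h q ((es ! i) q))"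
      by (rule smooth_section_on_subset) simp
  qed
  moreover have "(\<Sum>i<length es. c i q *\<^sub>R h q ((es ! i) q)) = h q (s q)" if "q \<in> W \<inter> V" for q
  proof -
    have "linear_between (fibre E q) (fibre F q) (h q)" using h by (simp add: vb_morphism_def)
    from linear_between_sum[OF this vector_bundle_subspace[OF E], of "{..<length es}" "\<lambda>i. (es ! i) q" "\<lambda>i. c i q"]
    show ?thesis using c(2)[of q] frame(4)[of q] that by simp
  qed
  ultimately have "smooth_section_on M F (W \<inter> V) (\<lambda>q. h q (s q))"
    by (rule smooth_section_on_cong)
  then show "\<exists>N. open N \<and> p \<in> N \<and> N \<subseteq> V \<and> smooth_section_on M F N (\<lambda>q. h q (s q))"
    using frame(1) \<open>open V\<close> \<open>p \<in> V\<close> W(2) by (intro exI[of _ "W \<inter> V"]) auto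
qed

text \<open>Extend \<open>v\<close> with constant coefficients in a frame and cut off by a bump function.\<close>

lemma section_through:
  assumes E: "vector_bundle M E" and "v \<in> fibre E p"
  obtains s where "s \<in> sections M E" "s p = v"
proof -
  obtain W es where W: "(W, es) \<in> frames E" "p \<in> W"
    using vector_bundle_frame_exists[OF E] by metis
  note frame = vector_bundle_frame[OF E W(1)]
  note sub = vector_bundle_subspace[OF E]
  obtain r where "v = (\<Sum>i<length (map (\<lambda>e. e p) es). r i *\<^sub>R map (\<lambda>e. e p) es ! i)"
    by (rule is_basis_expand[OF frame(2)[OF W(2)] assms(2)])
  then have r: "v = (\<Sum>i<length es. r i *\<^sub>R (es ! i) p)" by simp
  obtain \<eta> K where \<eta>: "smooth_fun_on M UNIV \<eta>" "closed K" "K \<subseteq> W" "\<And>q. q \<notin> K \<Longrightarrow> \<eta> q = 0" "\<eta> p = 1"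
    using bump_function_exists[OF frame(1) W(2)] by metis
  define s where "s q = (if q \<in> W then \<eta> q *\<^sub>R (\<Sum>i<length es. r i *\<^sub>R (es ! i) q) else 0)" for q
  have "smooth_section_on M E W (\<lambda>q. \<eta> q *\<^sub>R (\<Sum>i<length es. r i *\<^sub>R (es ! i) q))"
    using \<eta>(1) frame(3)
    by (intro smooth_section_on_scale smooth_section_on_sum sub smooth_fun_on_const)
       (auto intro: smooth_fun_on_subset)
  then have on_W: "smooth_section_on M E W s"
    by (rule smooth_section_on_cong) (simp add: s_def)
  have off_K: "smooth_section_on M E (- K) s"
    by (rule smooth_section_on_cong[OF smooth_section_on_zero[OF sub]]) (simp add: s_def \<eta>(4))
  have "smooth_section_on M E UNIV s"
  proof (rule smooth_section_on_local[OF vector_bundle_free_frames[OF E]])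
    fix q
    show "\<exists>N. open N \<and> q \<in> N \<and> N \<subseteq> UNIV \<and> smooth_section_on M E N s"
    proof (cases "q \<in> W")
      case True
      then show ?thesis using on_W frame(1) by (intro exI[of _ W]) simp
    next
      case False
      then show ?thesis using off_K open_Compl[OF \<eta>(2)] \<eta>(3) by (intro exI[of _ "- K"]) auto
    qed
  qed
  moreover have "s p = v" using W(2) \<eta>(5) r by (simp add: s_def)
  ultimately show thesis using that by (simp add: sections_def)
qed

end

section \<open>Courant algebroids\<close>

lemma courant_algebroidD:
  assumes "courant_algebroid M C"
  shows "vector_bundle M C" "vb_morphism M C (tangent_bundle M) (anchor C)" "bilinear_bracket M C"
    and "\<And>p v. v \<in> fibre C p \<Longrightarrow> linear_between (fibre C p) UNIV (pairing C p v)"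
    and "\<And>p v w. v \<in> fibre C p \<Longrightarrow> w \<in> fibre C p \<Longrightarrow> pairing C p v w = pairing C p w v"
    and "\<And>p v. v \<in> fibre C p \<Longrightarrow> (\<And>w. w \<in> fibre C p \<Longrightarrow> pairing C p v w = 0) \<Longrightarrow> v = 0"
    and "\<And>W es e e'. (W, es) \<in> frames C \<Longrightarrow> e \<in> set es \<Longrightarrow> e' \<in> set es \<Longrightarrow>
           smooth_fun_on M W (\<lambda>p. pairing C p (e p) (e' p))"
    and "\<And>c1 c2 c3. c1 \<in> sections M C \<Longrightarrow> c2 \<in> sections M C \<Longrightarrow> c3 \<in> sections M C \<Longrightarrow>
           bracket C c1 (bracket C c2 c3) = bracket C (bracket C c1 c2) c3 + bracket C c2 (bracket C c1 c3)"
    and "\<And>c1 c2 c3 p. c1 \<in> sections M C \<Longrightarrow> c2 \<in> sections M C \<Longrightarrow> c3 \<in> sections M C \<Longrightarrow>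
           anchor C p (c1 p) (\<lambda>q. pairing C q (c2 q) (c3 q)) =
             pairing C p (bracket C c1 c2 p) (c3 p) + pairing C p (c2 p) (bracket C c1 c3 p)"
    and "\<And>c1 c2. c1 \<in> sections M C \<Longrightarrow> c2 \<in> sections M C \<Longrightarrow>
           bracket C c1 c2 + bracket C c2 c1 = courant_D C (\<lambda>q. pairing C q (c1 q) (c2 q))"
proof -
  note h = assms[unfolded courant_algebroid_def]
  note h1 = conjunct1[OF h] and h = conjunct2[OF h]
  note h2 = conjunct1[OF h] and h = conjunct2[OF h]
  note h3 = conjunct1[OF h] and h = conjunct2[OF h]
  note h4 = conjunct1[OF h] and h = conjunct2[OF h]
  note h5 = conjunct1[OF h] and h = conjunct2[OF h]
  note h6 = conjunct1[OF h] and h = conjunct2[OF h]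
  note h7 = conjunct1[OF h] and h = conjunct2[OF h]
  note h8 = conjunct1[OF h] and h = conjunct2[OF h]
  note h9 = conjunct1[OF h] and h10 = conjunct2[OF h]
  show "vector_bundle M C" "vb_morphism M C (tangent_bundle M) (anchor C)" "bilinear_bracket M C"
    by (rule h1, rule h2, rule h3)
  show "\<And>p v. v \<in> fibre C p \<Longrightarrow> linear_between (fibre C p) UNIV (pairing C p v)"
    by (rule h4[rule_format])
  show "\<And>p v w. v \<in> fibre C p \<Longrightarrow> w \<in> fibre C p \<Longrightarrow> pairing C p v w = pairing C p w v"
    by (rule h5[rule_format])
  show "\<And>p v. v \<in> fibre C p \<Longrightarrow> (\<And>w. w \<in> fibre C p \<Longrightarrow> pairing C p v w = 0) \<Longrightarrow> v = 0"
    by (rule h6[rule_format])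
  show "smooth_fun_on M W (\<lambda>p. pairing C p (e p) (e' p))"
    if "(W, es) \<in> frames C" "e \<in> set es" "e' \<in> set es" for W es e e'
    using bspec[OF h7 that(1)] that(2,3) by simp
  show "\<And>c1 c2 c3. c1 \<in> sections M C \<Longrightarrow> c2 \<in> sections M C \<Longrightarrow> c3 \<in> sections M C \<Longrightarrow>
      bracket C c1 (bracket C c2 c3) = bracket C (bracket C c1 c2) c3 + bracket C c2 (bracket C c1 c3)"
    by (rule h8[rule_format])
  show "\<And>c1 c2 c3 p. c1 \<in> sections M C \<Longrightarrow> c2 \<in> sections M C \<Longrightarrow> c3 \<in> sections M C \<Longrightarrow>
      anchor C p (c1 p) (\<lambda>q. pairing C q (c2 q) (c3 q)) =
        pairing C p (bracket C c1 c2 p) (c3 p) + pairing C p (c2 p) (bracket C c1 c3 p)"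
    by (rule h9[rule_format])
  show "\<And>c1 c2. c1 \<in> sections M C \<Longrightarrow> c2 \<in> sections M C \<Longrightarrow>
      bracket C c1 c2 + bracket C c2 c1 = courant_D C (\<lambda>q. pairing C q (c1 q) (c2 q))"
    by (rule h10[rule_format])
qed

lemma courant_anchor_tangent:
  assumes "courant_algebroid M C" "v \<in> fibre C p"
  shows "anchor C p v \<in> tangent_space M p"
proof -
  have "linear_between (fibre C p) (tangent_space M p) (anchor C p)"
    using courant_algebroidD(2)[OF assms(1)] by (simp add: vb_morphism_def tangent_bundle_def)
  then show ?thesis using assms(2) unfolding linear_between_def by (simp add: image_subset_iff)
qed

lemma linear_between_subset:
  assumes "linear_between S T h" "S' \<subseteq> S" "h ` S' \<subseteq> T'"
  shows "linear_between S' T' h"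
  using assms(1,3) subsetD[OF assms(2)] by (simp add: linear_between_def)

lemma bilinear_bracketD:
  assumes "bilinear_bracket M L" "s \<in> sections M L"
  shows "linear_between (sections M L) (sections M L) (\<lambda>t. bracket L s t)"
    "linear_between (sections M L) (sections M L) (\<lambda>t. bracket L t s)"
  using assms by (auto simp: bilinear_bracket_def)

lemma bracket_in_sections:
  assumes "bilinear_bracket M L" "s \<in> sections M L" "t \<in> sections M L"
  shows "bracket L s t \<in> sections M L"
  using bilinear_bracketD(1)[OF assms(1,2)] assms(3) by (auto simp: linear_between_def)

lemma dirac_algebroid_simps [simp]:
  "fibre (dirac_algebroid C U) = fibre U" "frames (dirac_algebroid C U) = frames U"
  "anchor (dirac_algebroid C U) = anchor C" "bracket (dirac_algebroid C U) = bracket C"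
  "vector_bundle M (dirac_algebroid C U) \<longleftrightarrow> vector_bundle M U"
  "sections M (dirac_algebroid C U) = sections M U"
  "vb_morphism M (dirac_algebroid C U) F h \<longleftrightarrow> vb_morphism M U F h"
  by (simp_all add: dirac_algebroid_def vector_bundle_def sections_def smooth_section_on_def vb_morphism_def)

context manifold
begin

text \<open>The anchor is a derivation of smooth functions only, so that the pairings to which it is applied
  have to be known to be smooth.\<close>

lemma smooth_fun_on_pairing:
  assumes C: "courant_algebroid M C" and s: "s \<in> sections M C" and t: "t \<in> sections M C"
  shows "smooth_fun_on M UNIV (\<lambda>q. pairing C q (s q) (t q))"
proof (rule smooth_fun_on_local)
  fix p
  note CD = courant_algebroidD[OF C]
  obtain W es where W: "(W, es) \<in> frames C" "p \<in> W"
    using vector_bundle_frame_exists[OF CD(1)] by metis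
  note frame = vector_bundle_frame[OF CD(1) W(1)]
  obtain c where c: "\<And>i. i < length es \<Longrightarrow> smooth_fun_on M (W \<inter> UNIV) (c i)"
    "\<And>q. q \<in> W \<Longrightarrow> q \<in> UNIV \<Longrightarrow> s q = (\<Sum>i<length es. c i q *\<^sub>R (es ! i) q)"
    using smooth_section_on_coeffs[OF s[unfolded sections_def mem_Collect_eq] W(1)] by metis
  obtain d where d: "\<And>i. i < length es \<Longrightarrow> smooth_fun_on M (W \<inter> UNIV) (d i)"
    "\<And>q. q \<in> W \<Longrightarrow> q \<in> UNIV \<Longrightarrow> t q = (\<Sum>i<length es. d i q *\<^sub>R (es ! i) q)"
    using smooth_section_on_coeffs[OF t[unfolded sections_def mem_Collect_eq] W(1)] by metis
  have "smooth_fun_on M W (\<lambda>q. \<Sum>i<length es. c i q * (\<Sum>j<length es. d j q * pairing C q ((es ! i) q) ((es ! j) q)))"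
    using c(1) d(1) CD(7)[OF W(1)] by (intro smooth_fun_on_sum smooth_fun_on_mult) auto
  moreover have "(\<Sum>i<length es. c i q * (\<Sum>j<length es. d j q * pairing C q ((es ! i) q) ((es ! j) q)))
      = pairing C q (s q) (t q)" if q: "q \<in> W" for q
  proof -
    have mem: "(es ! i) q \<in> fibre C q" if "i \<in> {..<length es}" for i
      using frame(4)[OF q] that by simp
    have expand: "pairing C q v (\<Sum>j<length es. a j *\<^sub>R (es ! j) q) = (\<Sum>j<length es. a j *\<^sub>R pairing C q v ((es ! j) q))"
      if "v \<in> fibre C q" for v a
      by (rule linear_between_sum[OF CD(4)[OF that] vector_bundle_subspace[OF CD(1)] mem])
    have "pairing C q (s q) (t q) = pairing C q (t q) (s q)"
      by (rule CD(5)[OF sections_fibre[OF s] sections_fibre[OF t]])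
    also have "\<dots> = pairing C q (t q) (\<Sum>i<length es. c i q *\<^sub>R (es ! i) q)"
      using c(2)[OF q] by simp
    also have "\<dots> = (\<Sum>i<length es. c i q *\<^sub>R pairing C q (t q) ((es ! i) q))"
      by (rule expand[OF sections_fibre[OF t]])
    also have "\<dots> = (\<Sum>i<length es. c i q * (\<Sum>j<length es. d j q * pairing C q ((es ! i) q) ((es ! j) q)))"
    proof (rule sum.cong[OF refl])
      fix i assume i: "i \<in> {..<length es}"
      have "pairing C q (t q) ((es ! i) q) = pairing C q ((es ! i) q) (t q)"
        by (rule CD(5)[OF sections_fibre[OF t] mem[OF i]])
      then have "pairing C q (t q) ((es ! i) q) = pairing C q ((es ! i) q) (\<Sum>j<length es. d j q *\<^sub>R (es ! j) q)"
        using d(2)[OF q] by simp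
      with expand[OF mem[OF i], of "\<lambda>j. d j q"]
      show "c i q *\<^sub>R pairing C q (t q) ((es ! i) q)
          = c i q * (\<Sum>j<length es. d j q * pairing C q ((es ! i) q) ((es ! j) q))" by simp
    qed
    finally show ?thesis by (rule sym)
  qed
  ultimately have "smooth_fun_on M W (\<lambda>q. pairing C q (s q) (t q))"
    by (rule smooth_fun_on_cong[OF frame(1)])
  then show "\<exists>O'. open O' \<and> p \<in> O' \<and> smooth_fun_on M O' (\<lambda>q. pairing C q (s q) (t q))"
    using frame(1) W(2) by blast
qed

lemma tangent_vector_zero:
  assumes "X \<in> tangent_space M p"
  shows "X (\<lambda>q. 0) = 0"
proof -
  have "X (0 *\<^sub>R (\<lambda>q. 0)) = 0 *\<^sub>R X (\<lambda>q. 0)"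
    using assms smooth_fun_on_const[of UNIV 0] by (simp only: tangent_space_def linear_between_def) blast
  then show ?thesis by (simp add: scaleR_fun_def)
qed

text \<open>The Leibniz rule follows from invariance of the pairing.  Differentiate \<open>\<langle>f t, c\<rangle> = f \<langle>t, c\<rangle>\<close> along \<open>s\<close>
  and apply invariance to both pairings; as sections pass through all vectors \<open>c p\<close>,
  nondegeneracy gives the rule at \<open>p\<close>.\<close>

lemma courant_leibniz:
  assumes C: "courant_algebroid M C" and s: "s \<in> sections M C" and t: "t \<in> sections M C"
    and f: "smooth_fun_on M UNIV f"
  shows "bracket C s (\<lambda>p. f p *\<^sub>R t p) = (\<lambda>p. f p *\<^sub>R bracket C s t p + anchor C p (s p) f *\<^sub>R t p)"
proof
  fix p
  note CD = courant_algebroidD[OF C]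
  note sub = vector_bundle_subspace[OF CD(1)]
  define ft where "ft = (\<lambda>p. f p *\<^sub>R t p)"
  have ft: "ft \<in> sections M C"
    using smooth_section_on_scale[OF sub f, of t] t by (simp add: sections_def ft_def)
  note st = bracket_in_sections[OF CD(3) s t] and sft = bracket_in_sections[OF CD(3) s ft]
  define r where "r = f p *\<^sub>R bracket C s t p + anchor C p (s p) f *\<^sub>R t p"
  define x where "x = bracket C s ft p"
  have x: "x \<in> fibre C p" unfolding x_def by (rule sections_fibre[OF sft])
  have r: "r \<in> fibre C p"
    unfolding r_def by (intro subspace_add subspace_scale sub sections_fibre[OF st] sections_fibre[OF t])
  have pairing_comb: "pairing C q (a *\<^sub>R v + b *\<^sub>R w) z = a * pairing C q v z + b * pairing C q w z"
    if "v \<in> fibre C q" "w \<in> fibre C q" "z \<in> fibre C q" for q a b v w z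
  proof -
    have mem: "a *\<^sub>R v \<in> fibre C q" "b *\<^sub>R w \<in> fibre C q"
      using that by (auto intro: subspace_scale sub)
    have lin: "\<And>v w. v \<in> fibre C q \<Longrightarrow> w \<in> fibre C q \<Longrightarrow> pairing C q z (v + w) = pairing C q z v + pairing C q z w"
      "\<And>r v. v \<in> fibre C q \<Longrightarrow> pairing C q z (r *\<^sub>R v) = r *\<^sub>R pairing C q z v"
      using CD(4)[OF that(3)] unfolding linear_between_def by blast+
    show ?thesis
      using lin(1)[OF mem] lin(2)[OF that(1), of a] lin(2)[OF that(2), of b]
        CD(5)[OF that(1,3)] CD(5)[OF that(2,3)] CD(5)[OF subspace_add[OF sub mem] that(3)]
      by simp
  qed
  have "pairing C p x v = pairing C p r v" if v: "v \<in> fibre C p" for v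
  proof -
    obtain c where c: "c \<in> sections M C" "c p = v"
      using section_through[OF CD(1) v] by metis
    have ft_c: "pairing C q (ft q) z = f q * pairing C q (t q) z" if "z \<in> fibre C q" for q z
      using pairing_comb[OF sections_fibre[OF t] sections_fibre[OF t] that, of "f q" 0] by (simp add: ft_def)
    let ?g = "\<lambda>q. pairing C q (t q) (c q)"
    have "(\<lambda>q. pairing C q (ft q) (c q)) = f * ?g"
      using ft_c[OF sections_fibre[OF c(1)]] by (simp add: times_fun_def)
    moreover have "anchor C p (s p) (f * ?g) = anchor C p (s p) f * ?g p + f p * anchor C p (s p) ?g"
    proof -
      have "\<forall>f\<in>smooth_funs M. \<forall>g\<in>smooth_funs M.
          anchor C p (s p) (f * g) = anchor C p (s p) f * g p + f p * anchor C p (s p) g"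
        using courant_anchor_tangent[OF C sections_fibre[OF s], of p] by (simp add: tangent_space_def)
      then show ?thesis using f smooth_fun_on_pairing[OF C t c(1)] by simp
    qed
    ultimately have "pairing C p x (c p) + pairing C p (ft p) (bracket C s c p)
        = anchor C p (s p) f * ?g p + f p * (pairing C p (bracket C s t p) (c p) + pairing C p (t p) (bracket C s c p))"
      using CD(9)[OF s ft c(1), of p] CD(9)[OF s t c(1), of p] by (simp add: x_def)
    then show ?thesis
      using ft_c[OF sections_fibre[OF bracket_in_sections[OF CD(3) s c(1)]], of p]
        pairing_comb[OF sections_fibre[OF st] sections_fibre[OF t] v, of "f p" "anchor C p (s p) f"]
      by (simp add: r_def c(2) algebra_simps)
  qed
  then have "pairing C p (x - r) v = 0" if "v \<in> fibre C p" for v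
    using pairing_comb[OF x r that, of 1 "- 1"] that by simp
  then have "x - r = 0" by (intro CD(6)[OF subspace_diff[OF sub x r]])
  then show "bracket C s (\<lambda>p. f p *\<^sub>R t p) p = f p *\<^sub>R bracket C s t p + anchor C p (s p) f *\<^sub>R t p"
    by (simp add: x_def r_def ft_def)
qed

lemma courant_D_zero:
  assumes C: "courant_algebroid M C"
  shows "courant_D C (\<lambda>q. 0) = 0"
proof
  fix p
  note CD = courant_algebroidD[OF C]
  note sub = vector_bundle_subspace[OF CD(1)]
  have anchor: "anchor C p c (\<lambda>q. 0) = 0" if "c \<in> fibre C p" for c
    by (rule tangent_vector_zero[OF courant_anchor_tangent[OF C that]])
  have "pairing C p 0 c = 0" if "c \<in> fibre C p" for c
    using CD(5)[OF subspace_0[OF sub] that] linear_between_zero[OF CD(4)[OF that] sub] by simp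
  with anchor subspace_0[OF sub]
  have "(THE d. d \<in> fibre C p \<and> (\<forall>c\<in>fibre C p. pairing C p d c = anchor C p c (\<lambda>q. 0))) = 0"
  proof (intro the_equality)
    fix d assume "d \<in> fibre C p \<and> (\<forall>c\<in>fibre C p. pairing C p d c = anchor C p c (\<lambda>q. 0))"
    with anchor show "d = 0" by (intro CD(6)[of d p]) simp_all
  qed simp_all
  then show "courant_D C (\<lambda>q. 0) p = 0 p" by (simp add: courant_D_def)
qed

section \<open>Dirac structures are Lie algebroids\<close>

text \<open>On sections of \<open>U\<close> the pairing vanishes, so that the symmetric part \<open>\<D> \<langle>s, t\<rangle>\<close> of the bracket does.
  By the resulting antisymmetry, the Leibniz form of the Jacobi identity becomes the cyclic form.\<close>

theorem dirac_structure_lie_algebroid: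
  assumes C: "courant_algebroid M C" and U: "dirac_structure M C U"
  shows "lie_algebroid M (dirac_algebroid C U)"
proof -
  note CD = courant_algebroidD[OF C]
  have vbU: "vector_bundle M U" and fib: "\<And>p. fibre U p \<subseteq> fibre C p" and inc: "vb_morphism M U C (\<lambda>p v. v)"
    using U by (auto simp: dirac_structure_def subbundle_def)
  have iso: "pairing C p u v = 0" if "u \<in> fibre U p" "v \<in> fibre U p" for p u v
    using U that unfolding dirac_structure_def by blast
  have closed: "bracket C s t \<in> sections M U" if "s \<in> sections M U" "t \<in> sections M U" for s t
    using U that unfolding dirac_structure_def by blast
  have smooth_inc: "smooth_section_on M C V s" if "open V" "smooth_section_on M U V s" for V s
    using vb_morphism_smooth_section[OF vbU vector_bundle_free_frames[OF CD(1)] inc that] .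
  have sec: "sections M U \<subseteq> sections M C"
    using smooth_inc[OF open_UNIV] by (auto simp: sections_def)
  have anti: "bracket C s t = - bracket C t s" if s: "s \<in> sections M U" and t: "t \<in> sections M U" for s t
  proof -
    have "(\<lambda>q. pairing C q (s q) (t q)) = (\<lambda>q. 0)"
      using iso[OF sections_fibre[OF s] sections_fibre[OF t]] by (rule ext)
    then have "bracket C s t + bracket C t s = 0"
      using CD(10)[OF subsetD[OF sec s] subsetD[OF sec t]] courant_D_zero[OF C] by simp
    then show ?thesis by (rule eq_neg_iff_add_eq_0[THEN iffD2])
  qed
  have "vb_morphism M U (tangent_bundle M) (anchor C)"
    unfolding vb_morphism_def
  proof (intro conjI allI ballI)
    show "linear_between (fibre U p) (fibre (tangent_bundle M) p) (anchor C p)" for p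
    proof (rule linear_between_subset[OF _ fib])
      show h: "linear_between (fibre C p) (fibre (tangent_bundle M) p) (anchor C p)"
        using CD(2) by (simp add: vb_morphism_def)
      show "anchor C p ` fibre U p \<subseteq> fibre (tangent_bundle M) p"
        using courant_anchor_tangent[OF C] fib[of p] by (auto simp: tangent_bundle_def)
    qed
    fix x assume x: "x \<in> frames U"
    obtain W es where W: "x = (W, es)" by (cases x)
    note frame = vector_bundle_frame[OF vbU x[unfolded W]]
    \<comment> \<open>A frame of \<open>U\<close> consists of smooth local sections of \<open>C\<close>, which the anchor of \<open>C\<close> maps to smooth vector fields.\<close>
    have "smooth_section_on M (tangent_bundle M) W (\<lambda>p. anchor C p (e p))" if "e \<in> set es" for e
      by (rule vb_morphism_smooth_section[OF CD(1) free_frames_tangent_bundle CD(2) frame(1)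
            smooth_inc[OF frame(1) frame(3)[OF that]]])
    then show "case x of (W, es) \<Rightarrow> \<forall>e\<in>set es. smooth_section_on M (tangent_bundle M) W (\<lambda>p. anchor C p (e p))"
      by (simp add: W)
  qed
  moreover have "bilinear_bracket M (dirac_algebroid C U)"
    unfolding bilinear_bracket_def dirac_algebroid_simps
  proof (intro ballI conjI)
    fix s assume s: "s \<in> sections M U"
    then have "s \<in> sections M C" using sec by blast
    note lin = bilinear_bracketD[OF CD(3) this]
    show "linear_between (sections M U) (sections M U) (\<lambda>t. bracket C s t)"
      using closed[OF s] by (intro linear_between_subset[OF lin(1) sec] image_subsetI)
    show "linear_between (sections M U) (sections M U) (\<lambda>t. bracket C t s)"
      using closed[OF _ s] by (intro linear_between_subset[OF lin(2) sec] image_subsetI)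
  qed
  moreover have "bracket C s (bracket C t u) + bracket C t (bracket C u s) + bracket C u (bracket C s t) = 0"
    if s: "s \<in> sections M U" and t: "t \<in> sections M U" and u: "u \<in> sections M U" for s t u
  proof -
    have inC: "s \<in> sections M C" "t \<in> sections M C" "u \<in> sections M C" using s t u sec by auto
    have neg: "bracket C t (- bracket C s u) = - bracket C t (bracket C s u)"
    proof -
      have "bracket C t ((- 1) *\<^sub>R bracket C s u) = (- 1) *\<^sub>R bracket C t (bracket C s u)"
        using bilinear_bracketD(1)[OF CD(3) inC(2)] bracket_in_sections[OF CD(3) inC(1,3)]
        unfolding linear_between_def by blast
      then show ?thesis by simp
    qed
    have "bracket C s (bracket C t u) + bracket C t (bracket C u s) + bracket C u (bracket C s t)
        = bracket C s (bracket C t u) - bracket C t (bracket C s u) - bracket C (bracket C s t) u"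
      using anti[OF u s] anti[OF u closed[OF s t]] neg by simp
    then show ?thesis using CD(8)[OF inC] by simp
  qed
  moreover have "bracket C s (\<lambda>p. f p *\<^sub>R t p) = (\<lambda>p. f p *\<^sub>R bracket C s t p + anchor C p (s p) f *\<^sub>R t p)"
    if "s \<in> sections M U" "t \<in> sections M U" "f \<in> smooth_funs M" for s t f
    using courant_leibniz[OF C] that sec by blast
  ultimately show ?thesis
    unfolding lie_algebroid_def dirac_algebroid_simps
    using vbU anti by (intro conjI ballI) blast+
qed

end

section \<open>The bijection\<close>

text \<open>A section of the image is \<open>\<iota>\<close> of a section with the same coefficients.  So the sections of the image depend
  only on the sections of the bundle, not on its frames.\<close>

lemma sections_image_algebroid:
  assumes U: "vector_bundle M U" and lin: "\<And>p. linear_between (fibre U p) (T p) (\<iota> p)"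
    and inj: "\<And>p. inj_on (\<iota> p) (fibre U p)"
  shows "s \<in> sections M (image_algebroid U \<iota>) \<longleftrightarrow>
    (\<forall>p. s p \<in> \<iota> p ` fibre U p) \<and> (\<lambda>p. the_inv_into (fibre U p) (\<iota> p) (s p)) \<in> sections M U"
proof (cases "\<forall>p. s p \<in> \<iota> p ` fibre U p")
  case False
  then show ?thesis by (auto simp: sections_def smooth_section_on_def image_algebroid_def)
next
  case True
  define r where "r p = the_inv_into (fibre U p) (\<iota> p) (s p)" for p
  have r: "r p \<in> fibre U p" "\<iota> p (r p) = s p" for p
    using True the_inv_into_into[OF inj _ order_refl] f_the_inv_into_f[OF inj] by (auto simp: r_def)
  have coeffs: "s p = (\<Sum>i<length es. c i p *\<^sub>R \<iota> p ((es ! i) p)) \<longleftrightarrow> r p = (\<Sum>i<length es. c i p *\<^sub>R (es ! i) p)"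
    if W: "(W, es) \<in> frames U" "p \<in> W" for W es p and c
  proof -
    have mem: "(es ! i) p \<in> fibre U p" if "i \<in> {..<length es}" for i
      using vector_bundle_frame(4)[OF U W] that by simp
    have "(\<Sum>i<length es. c i p *\<^sub>R \<iota> p ((es ! i) p)) = \<iota> p (\<Sum>i<length es. c i p *\<^sub>R (es ! i) p)"
      by (rule linear_between_sum[OF lin vector_bundle_subspace[OF U] mem, symmetric])
    moreover have "(\<Sum>i<length es. c i p *\<^sub>R (es ! i) p) \<in> fibre U p"
      by (intro subspace_sum subspace_scale vector_bundle_subspace[OF U] mem)
    ultimately show ?thesis using inj_on_eq_iff[OF inj r(1)] r(2)[of p] by metis
  qed
  have "s \<in> sections M (image_algebroid U \<iota>) \<longleftrightarrow>
      (\<forall>(W, es)\<in>frames U. \<exists>c. (\<forall>i<length es. smooth_fun_on M (W \<inter> UNIV) (c i)) \<and>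
         (\<forall>p\<in>W \<inter> UNIV. s p = (\<Sum>i<length es. c i p *\<^sub>R \<iota> p ((es ! i) p))))"
  proof -
    have frames: "frames (image_algebroid U \<iota>) = (\<lambda>(W, es). (W, map (\<lambda>e p. \<iota> p (e p)) es)) ` frames U"
      by (auto simp: image_algebroid_def)
    have "\<forall>p\<in>UNIV. s p \<in> fibre (image_algebroid U \<iota>) p" using True by (simp add: image_algebroid_def)
    then show ?thesis
      unfolding sections_def smooth_section_on_def mem_Collect_eq frames ball_simps
      by (simp add: case_prod_unfold cong: sum.cong_simp)
  qed
  also have "\<dots> \<longleftrightarrow> (\<forall>(W, es)\<in>frames U. \<exists>c. (\<forall>i<length es. smooth_fun_on M (W \<inter> UNIV) (c i)) \<and>
         (\<forall>p\<in>W \<inter> UNIV. r p = (\<Sum>i<length es. c i p *\<^sub>R (es ! i) p)))"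
  proof (rule ball_cong[OF refl])
    fix x assume "x \<in> frames U"
    then obtain W es where x: "x = (W, es)" "(W, es) \<in> frames U" by (cases x) simp
    show "(case x of (W, es) \<Rightarrow> \<exists>c. (\<forall>i<length es. smooth_fun_on M (W \<inter> UNIV) (c i)) \<and>
         (\<forall>p\<in>W \<inter> UNIV. s p = (\<Sum>i<length es. c i p *\<^sub>R \<iota> p ((es ! i) p)))) \<longleftrightarrow>
      (case x of (W, es) \<Rightarrow> \<exists>c. (\<forall>i<length es. smooth_fun_on M (W \<inter> UNIV) (c i)) \<and>
         (\<forall>p\<in>W \<inter> UNIV. r p = (\<Sum>i<length es. c i p *\<^sub>R (es ! i) p)))"
      by (simp add: x(1) coeffs[OF x(2)])
  qed
  also have "\<dots> \<longleftrightarrow> r \<in> sections M U"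
    using r(1) by (simp add: sections_def smooth_section_on_def)
  finally show ?thesis using True by (simp add: r_def[abs_def])
qed

lemma same_algebroid_image:
  assumes U: "vector_bundle M U" and V: "vector_bundle M V"
    and lin: "\<And>p. linear_between (fibre U p) (T p) (\<iota> p)" and inj: "\<And>p. inj_on (\<iota> p) (fibre U p)"
    and same: "same_algebroid M U V"
  shows "same_algebroid M (image_algebroid U \<iota>) (image_algebroid V \<iota>)"
proof -
  have fib: "fibre V = fibre U" and sec: "sections M V = sections M U"
    and br: "\<And>s t. s \<in> sections M U \<Longrightarrow> t \<in> sections M U \<Longrightarrow> bracket V s t = bracket U s t"
    using same by (auto simp: same_algebroid_def)
  note secU = sections_image_algebroid[OF U lin inj]
  have secV: "s \<in> sections M (image_algebroid V \<iota>) \<longleftrightarrow> s \<in> sections M (image_algebroid U \<iota>)" for s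
    using sections_image_algebroid[OF V, of T \<iota> s] lin inj secU[of s] by (simp add: fib sec)
  have "bracket (image_algebroid U \<iota>) s t = bracket (image_algebroid V \<iota>) s t"
    if "s \<in> sections M (image_algebroid U \<iota>)" "t \<in> sections M (image_algebroid U \<iota>)" for s t
    using that br unfolding secU by (simp add: image_algebroid_def fib)
  moreover have "sections M (image_algebroid U \<iota>) = sections M (image_algebroid V \<iota>)"
    using secV by blast
  ultimately show ?thesis
    by (simp add: same_algebroid_def) (simp add: image_algebroid_def fib)
qed

lemma bij_betw_quotient:
  assumes R: "equiv A R" and S: "equiv B S" and map: "f ` A \<subseteq> B"
    and iff: "\<And>x y. x \<in> A \<Longrightarrow> y \<in> A \<Longrightarrow> (x, y) \<in> R \<longleftrightarrow> (f x, f y) \<in> S"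
    and onto: "\<And>b. b \<in> B \<Longrightarrow> \<exists>a\<in>A. (f a, b) \<in> S"
  shows "\<exists>F. bij_betw F (A // R) (B // S) \<and> (\<forall>x\<in>A. F (R `` {x}) = S `` {f x})"
proof -
  define F where "F X = S `` (f ` X)" for X
  have F: "F (R `` {x}) = S `` {f x}" if x: "x \<in> A" for x
  proof
    have "S `` {f y} \<subseteq> S `` {f x}" if "(x, y) \<in> R" for y
    proof -
      have "y \<in> A" using that equiv_type[OF R] by blast
      then have "(f x, f y) \<in> S" using iff[OF x] that by simp
      from equiv_class_eq[OF S this] show ?thesis by simp
    qed
    then show "F (R `` {x}) \<subseteq> S `` {f x}" unfolding F_def by blast
    show "S `` {f x} \<subseteq> F (R `` {x})"
      using equiv_class_self[OF R x] unfolding F_def by blast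
  qed
  have "inj_on F (A // R)"
  proof (rule inj_onI)
    fix X Y assume X: "X \<in> A // R" and Y: "Y \<in> A // R" and eq: "F X = F Y"
    obtain x where x: "x \<in> A" "X = R `` {x}" using X by (rule quotientE)
    obtain y where y: "y \<in> A" "Y = R `` {y}" using Y by (rule quotientE)
    have "S `` {f x} = S `` {f y}" using eq F[OF x(1)] F[OF y(1)] x(2) y(2) by simp
    then have "(f x, f y) \<in> S" by (rule eq_equiv_class[OF _ S]) (use map y(1) in blast)
    then have "(x, y) \<in> R" using iff[OF x(1) y(1)] by simp
    then show "X = Y" using equiv_class_eq[OF R] x(2) y(2) by simp
  qed
  moreover have "F ` (A // R) = B // S"
  proof (intro equalityI subsetI)
    fix Y assume "Y \<in> F ` (A // R)"
    then obtain X where X: "X \<in> A // R" "Y = F X" by blast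
    obtain x where x: "x \<in> A" "X = R `` {x}" using X(1) by (rule quotientE)
    then have "Y = S `` {f x}" using F X(2) by simp
    moreover have "f x \<in> B" using map x(1) by blast
    ultimately show "Y \<in> B // S" by (simp add: quotientI)
  next
    fix Y assume "Y \<in> B // S"
    then obtain b where b: "b \<in> B" "Y = S `` {b}" by (rule quotientE)
    then obtain a where a: "a \<in> A" "(f a, b) \<in> S" using onto by blast
    then have "Y = F (R `` {a})" using F[OF a(1)] equiv_class_eq[OF S a(2)] b(2) by simp
    then show "Y \<in> F ` (A // R)" using quotientI[OF a(1)] by blast
  qed
  ultimately show ?thesis using F by (auto simp: bij_betw_def)
qed

lemma A_manin_pair_dirac_bialgebroid:
  assumes "smooth_manifold M" "A_manin_pair M A C U \<iota> \<Phi>"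
  shows "dirac_bialgebroid M A (dirac_algebroid C U) \<iota>"
proof -
  interpret manifold M by standard (rule assms(1))
  have "lie_algebroid M (dirac_algebroid C U)"
    using assms(2) by (intro dirac_structure_lie_algebroid) (simp_all add: A_manin_pair_def manin_pair_def)
  moreover have "same_algebroid M (dirac_algebroid C U) (dirac_algebroid C U)"
    by (simp add: same_algebroid_def)
  ultimately show ?thesis
    using assms(2) unfolding dirac_bialgebroid_def by (auto simp: A_manin_pair_def)
qed

theorem proposition3p2:
  fixes M :: "('m::{t2_space,second_countable_topology}, 'e::real_inner) atlas"
    and A :: "('m, 'a::real_vector) algebroid"
  assumes "smooth_manifold M" and "lie_algebroid M A"
  shows "\<exists>F. bij_betw F
             ((A_manin_pairs M A :: ('m, 'a, 'c::real_vector) A_manin_data set) // manin_equiv M A)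
             ((dirac_bialgebroids M A :: ('m, 'a, 'c) bialgebroid_data set) // bialgebroid_equiv M A) \<and>
           (\<forall>(C, U, \<iota>, \<Phi>)\<in>A_manin_pairs M A.
              F (manin_equiv M A `` {(C, U, \<iota>, \<Phi>)}) =
              bialgebroid_equiv M A `` {(dirac_algebroid C U, \<iota>)})"
proof -
  define f :: "('m, 'a, 'c) A_manin_data \<Rightarrow> ('m, 'a, 'c) bialgebroid_data" where
    "f = (\<lambda>(C, U, \<iota>, \<Phi>). (dirac_algebroid C U, \<iota>))"
  have map: "f x \<in> dirac_bialgebroids M A" if "x \<in> A_manin_pairs M A" for x
    using that A_manin_pair_dirac_bialgebroid[OF assms(1)]
    by (auto simp: f_def A_manin_pairs_def dirac_bialgebroids_def)
  have iff: "(x, y) \<in> manin_equiv M A \<longleftrightarrow> (f x, f y) \<in> bialgebroid_equiv M A"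
    if "x \<in> A_manin_pairs M A" "y \<in> A_manin_pairs M A" for x y
    using that map[OF that(1)] map[OF that(2)]
    by (auto simp: manin_equiv_def bialgebroid_equiv_def f_def split: prod.splits)
  have onto: "\<exists>a\<in>A_manin_pairs M A. (f a, b) \<in> bialgebroid_equiv M A"
    if "b \<in> dirac_bialgebroids M A" for b :: "('m, 'a, 'c) bialgebroid_data"
  proof -
    obtain U \<iota> where b: "b = (U, \<iota>)" by (cases b)
    then have U: "dirac_bialgebroid M A U \<iota>" using that by (simp add: dirac_bialgebroids_def)
    then obtain C V \<Phi> where C: "A_manin_pair M A C V \<iota> \<Phi>" and same: "same_algebroid M U (dirac_algebroid C V)"
      unfolding dirac_bialgebroid_def by blast
    \<comment> \<open>The Dirac structure of the witnessing pair need not equal \<open>U\<close> as a record, but its fibres, sections and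
      bracket are the same, and so is \<open>\<iota>\<close>; equivalence depends only on these.\<close>
    have "same_algebroid M (image_algebroid U \<iota>) (image_algebroid (dirac_algebroid C V) \<iota>)"
    proof (rule same_algebroid_image[OF _ _ _ _ same])
      show "vector_bundle M U" using U by (simp add: dirac_bialgebroid_def lie_algebroid_def)
      show "vector_bundle M (dirac_algebroid C V)"
        using C by (simp add: A_manin_pair_def manin_pair_def dirac_structure_def subbundle_def)
      show "linear_between (fibre U p) (fibre (tangent_plus_dual M A) p) (\<iota> p)"
        "inj_on (\<iota> p) (fibre U p)" for p
        using U by (simp_all add: dirac_bialgebroid_def injective_anchored_morphism_def vb_morphism_def)
    qed
    then have "same_algebroid M (image_algebroid (dirac_algebroid C V) \<iota>) (image_algebroid U \<iota>)"
      by (auto simp: same_algebroid_def)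
    moreover have pair: "(C, V, \<iota>, \<Phi>) \<in> A_manin_pairs M A" using C by (simp add: A_manin_pairs_def)
    ultimately have "(f (C, V, \<iota>, \<Phi>), b) \<in> bialgebroid_equiv M A"
      using that map[OF pair] by (auto simp: bialgebroid_equiv_def f_def b)
    with pair show ?thesis by blast
  qed
  have "f ` A_manin_pairs M A \<subseteq> dirac_bialgebroids M A" using map by blast
  from bij_betw_quotient[OF equiv_manin_equiv equiv_bialgebroid_equiv this iff onto]
  obtain F where "bij_betw F (A_manin_pairs M A // manin_equiv M A) (dirac_bialgebroids M A // bialgebroid_equiv M A)"
    and F: "\<forall>x\<in>A_manin_pairs M A. F (manin_equiv M A `` {x}) = bialgebroid_equiv M A `` {f x}"
    by blast
  moreover have "\<forall>(C, U, \<iota>, \<Phi>)\<in>A_manin_pairs M A.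
      F (manin_equiv M A `` {(C, U, \<iota>, \<Phi>)}) = bialgebroid_equiv M A `` {(dirac_algebroid C U, \<iota>)}"
    using F by (simp add: f_def case_prod_unfold)
  ultimately show ?thesis by (intro exI[of _ F] conjI)
qed

end
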